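(* As $n\to\infty$, $$\mathbb{E}(L_n M_n)=\mathbb{E}(L_n)+\frac{1}{2}\log n-C+O\left(\frac{1}{\log n}\right),$$ where $C=\log c+1-\gamma$, $c=\frac{\pi}{\sqrt{6}}$, and $\gamma$ is Euler's constant.
   Context: For an integer $n\ge 1$, a partition $\lambda$ of $n$ is a representation $n=\lambda_1+\lambda_2+\dots+\lambda_k$ with $k\ge 1$ and positive integers $\lambda_1\ge\lambda_2\ge\dots\ge\lambda_k$. Let $\Lambda(n)$ be the set of all partitions of $n$ and $p(n)=|\Lambda(n)|$. $\mathbb{P}$ denotes the uniform probability measure on $\Lambda(n)$ (each $\lambda\in\Lambda(n)$ has probability $1/p(n)$), and $\mathbb{E}$ is the expectation with respect to $\mathbb{P}$. For $\lambda\in\Lambda(n)$, $L_n=L_n(\lambda)=\lambda_1$ is the largest part size, and $M_n=M_n(\lambda)$ is the multiplicity of the largest part, i.e. the number of indices $j\in\{1,\dots,k\}$ with $\lambda_j=\lambda_1$. $\log$ is the natural logarithm and $\gamma=0.5772\ldots$ is Euler's constant. *)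

theory Defs
  imports "HOL-Probability.Probability"
begin

text \<open>
  A partition of \<open>n\<close> is the list of its parts in weakly decreasing order.  There is no partition
  of \<open>0\<close>, since at least one part is required.
\<close>

definition partitions :: "nat \<Rightarrow> nat list set" where
  "partitions n =
     {ps. ps \<noteq> [] \<and> sorted_wrt (\<ge>) ps \<and> (\<forall>x\<in>set ps. x > 0) \<and> sum_list ps = n}"

definition random_partition :: "nat \<Rightarrow> nat list pmf" where
  "random_partition n = pmf_of_set (partitions n)"

definition largest_part :: "nat list \<Rightarrow> nat" where
  "largest_part ps = hd ps"

definition largest_part_mult :: "nat list \<Rightarrow> nat" where
  "largest_part_mult ps = count_list ps (largest_part ps)"

text \<open>
  \<open>pmf_of_set\<close> is the uniform distribution only on finite non-empty sets, which the following facts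
  guarantee for \<open>n \<ge> 1\<close>.
\<close>

lemma finite_partitions: "finite (partitions n)"
proof (rule finite_subset)
  show "partitions n \<subseteq> {ps. set ps \<subseteq> {..n} \<and> length ps \<le> n}"
  proof
    fix ps assume "ps \<in> partitions n"
    then have pos: "\<forall>x\<in>set ps. x > 0" and sum: "sum_list ps = n"
      by (auto simp: partitions_def)
    have "length ps \<le> sum_list ps"
      using pos by (induction ps) auto
    moreover have "set ps \<subseteq> {..n}"
      using sum member_le_sum_list[of _ ps] by auto
    ultimately show "ps \<in> {ps. set ps \<subseteq> {..n} \<and> length ps \<le> n}"
      using sum by simp
  qed
  show "finite {ps. set ps \<subseteq> {..n} \<and> length ps \<le> n}"
    by (rule finite_lists_length_le) simp
qed

lemma partitions_nonempty: "n \<ge> 1 \<Longrightarrow> partitions n \<noteq> {}"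
proof -
  assume "n \<ge> 1"
  then have "[n] \<in> partitions n"
    by (simp add: partitions_def)
  then show ?thesis by blast
qed

lemma pmf_random_partition:
  "n \<ge> 1 \<Longrightarrow> ps \<in> partitions n \<Longrightarrow> pmf (random_partition n) ps = 1 / real (card (partitions n))"
  by (simp add: random_partition_def finite_partitions partitions_nonempty)

end

theory Submission
  imports Defs "HOL-Real_Asymp.Real_Asymp"
begin

text \<open>
  Write \<open>L\<close> for the largest part and \<open>M\<close> for its multiplicity.  Since \<open>L (M - 1)\<close> is
  \<open>L [M \<ge> 2]\<close> plus \<open>L (M - 2)\<close> on \<open>M \<ge> 3\<close>, and \<open>L M \<le> n\<close>, the difference of the two
  expectations equals the mean of \<open>L [M \<ge> 2]\<close> up to an error between \<open>0\<close> and the mean of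
  \<open>L [M \<ge> 3] + n [M \<ge> 4]\<close> (\<open>expectation_excess\<close>).

  Removing \<open>j\<close> copies of the largest part counts the partitions with \<open>M \<ge> j\<close>; call this number
  \<open>w j n\<close>, and let \<open>v j n\<close> be the sum of \<open>L\<close> over them.  Then \<open>w 1 = p\<close>,
  \<open>w (j+1) n = w j n - w j (n-j)\<close>, so that \<open>w j\<close> has the generating function
  \<open>(1-z)...(1-z^(j-1)) \<Prod>k. 1/(1-z^k)\<close>, and
  \<open>v j n = (\<Sum>a\<ge>j. \<Sum>b\<ge>1. w j (n - a b))\<close> (\<open>vsum_convolution\<close>).

  Put \<open>s = c / sqrt n\<close> and \<open>x = exp (-s)\<close>.  Fourier inversion on the circle of radius \<open>x\<close> writes
  \<open>w j (n-k)\<close> as \<open>x^k\<close> times an integral of the characteristic function of a sum of independent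
  geometric variables times bounded factors.  That characteristic function is \<open>O(r^4)\<close> with
  \<open>r = s^3 / (s^3 + t^2)\<close> (\<open>norm_size_char_le_kern\<close>), and near \<open>0\<close> it is close to a Gaussian
  centred at \<open>n + O(1/s)\<close>.  The Gaussian gives a lower bound for \<open>p n\<close>; the decay gives the upper
  bounds.  The result (\<open>wsum_bounds\<close>), uniform in \<open>k\<close>, is that \<open>w j (n-k) / p n\<close> is
  \<open>O(s^(j-1) x^k)\<close> and that \<open>w 2 (n-k) / p n\<close> is \<open>(1-x) x^k (1 + O(s^(1/2) (1 + s k)))\<close>.  No
  asymptotic formula for \<open>p n\<close> itself is needed.

  Hence the mean of \<open>L [M \<ge> 2]\<close> is \<open>(1-x) (\<Sum>a\<ge>2. x^a / (1-x^a))\<close> up to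
  \<open>O(s^(1/2) log n)\<close>, and the contributions of \<open>M \<ge> 3\<close> are \<open>O(s log n)\<close>.  Finally
  \<open>s (\<Sum>a\<ge>1. x^a / (1-x^a)) = \<gamma> - log s + O(s)\<close> (\<open>lambert_sum\<close>), by comparing the sum with
  the harmonic sum.  The term \<open>a = 1\<close> contributes \<open>1 + O(s)\<close>, which gives
  \<open>- log s + \<gamma> - 1 = log n / 2 - log c + \<gamma> - 1\<close>.
\<close>

section \<open>Partitions with bounded parts\<close>

text \<open>
  Partitions of \<open>m\<close> with all parts at most \<open>l\<close>, as weakly decreasing lists.  Unlike
  \<open>partitions\<close>, the empty list is allowed (for \<open>m = 0\<close>), and \<open>m\<close> is an integer, so that there are
  none for negative \<open>m\<close> and recursions need no case distinction.
\<close>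

definition bounded_partitions :: "int \<Rightarrow> nat \<Rightarrow> nat list set" where
  "bounded_partitions m l =
     {ps. sorted_wrt (\<ge>) ps \<and> (\<forall>x\<in>set ps. 0 < x \<and> x \<le> l) \<and> int (sum_list ps) = m}"

text \<open>
  The number of partitions of \<open>m\<close> into parts at most \<open>l\<close>.
\<close>

definition part_count :: "int \<Rightarrow> nat \<Rightarrow> nat" where
  "part_count m l = card (bounded_partitions m l)"

lemma bounded_partitions_neg: "m < 0 \<Longrightarrow> bounded_partitions m l = {}"
  by (auto simp: bounded_partitions_def)

lemma bounded_partitions_pos:
  assumes "m > 0"
  shows "bounded_partitions m l = {ps \<in> partitions (nat m). \<forall>x\<in>set ps. x \<le> l}"
  using assms by (auto simp: bounded_partitions_def partitions_def)

lemma bounded_partitions_0: "bounded_partitions 0 l = {[]}"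
proof -
  have "ps = []" if "ps \<in> bounded_partitions 0 l" for ps
    using that by (cases ps) (auto simp: bounded_partitions_def)
  moreover have "[] \<in> bounded_partitions 0 l"
    by (simp add: bounded_partitions_def)
  ultimately show ?thesis by blast
qed

lemma finite_bounded_partitions: "finite (bounded_partitions m l)"
  by (rule linorder_cases[of m 0])
     (auto simp: bounded_partitions_neg bounded_partitions_0 bounded_partitions_pos finite_partitions)

lemma part_count_neg: "m < 0 \<Longrightarrow> part_count m l = 0"
  by (simp add: part_count_def bounded_partitions_neg)

lemma part_count_zero: "part_count m 0 = (if m = 0 then 1 else 0)"
proof -
  have "bounded_partitions m 0 = (if m = 0 then {[]} else {})"
  proof -
    have "ps = []" if "ps \<in> bounded_partitions m 0" for ps
      using that by (cases ps) (auto simp: bounded_partitions_def)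
    then show ?thesis by (auto simp: bounded_partitions_def)
  qed
  then show ?thesis by (simp add: part_count_def)
qed

lemma part_count_Suc: "part_count m (Suc l) = part_count m l + part_count (m - int (Suc l)) (Suc l)"
proof -
  let ?B = "(#) (Suc l) ` bounded_partitions (m - int (Suc l)) (Suc l)"
  have "bounded_partitions m (Suc l) = bounded_partitions m l \<union> ?B"
  proof (intro equalityI subsetI)
    fix ps assume ps: "ps \<in> bounded_partitions m (Suc l)"
    show "ps \<in> bounded_partitions m l \<union> ?B"
    proof (cases ps)
      case Nil
      then show ?thesis using ps by (auto simp: bounded_partitions_def)
    next
      case (Cons x xs)
      show ?thesis
      proof (cases "x = Suc l")
        case True
        then show ?thesis using ps Cons by (auto simp: bounded_partitions_def)
      next
        case False
        then have "x \<le> l" using ps Cons by (auto simp: bounded_partitions_def)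
        then show ?thesis using ps Cons by (fastforce simp: bounded_partitions_def)
      qed
    qed
  next
    fix ps assume "ps \<in> bounded_partitions m l \<union> ?B"
    then show "ps \<in> bounded_partitions m (Suc l)"
      by (auto simp: bounded_partitions_def)
  qed
  moreover have "bounded_partitions m l \<inter> ?B = {}"
  proof -
    have "Suc l # qs \<notin> bounded_partitions m l" for qs
      unfolding bounded_partitions_def mem_Collect_eq by simp
    then show ?thesis by blast
  qed
  moreover have "card ?B = part_count (m - int (Suc l)) (Suc l)"
    unfolding part_count_def by (rule card_image) simp
  ultimately show ?thesis
    by (simp add: part_count_def card_Un_disjoint finite_bounded_partitions)
qed

text \<open>
  The number of partitions of \<open>m\<close> whose largest part has multiplicity at least \<open>j\<close>: after \<open>j\<close> copies
  of the largest part \<open>l\<close> are removed, a partition of \<open>m - j l\<close> into parts at most \<open>l\<close> remains.  The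
  term \<open>l = 0\<close> counts the empty partition of \<open>m = 0\<close>, which keeps the recursion in \<open>j\<close> exact.
\<close>

definition wsum :: "nat \<Rightarrow> int \<Rightarrow> real" where
  "wsum j m = (\<Sum>l\<le>nat m. real (part_count (m - int (j * l)) l))"

text \<open>
  The sum of the largest parts of the partitions counted by \<open>wsum j m\<close>.
\<close>

definition vsum :: "nat \<Rightarrow> int \<Rightarrow> real" where
  "vsum j m = (\<Sum>l\<le>nat m. real l * real (part_count (m - int (j * l)) l))"

lemma part_count_far: assumes "j \<ge> 1" "l > nat m" shows "part_count (m - int (j * l)) l = 0"
proof (rule part_count_neg)
  have "l \<le> j * l" using assms by simp
  then have "int l \<le> int (j * l)" by (simp only: of_nat_le_iff)
  moreover have "m < int l" using assms by linarith
  ultimately show "m - int (j * l) < 0" by linarith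
qed

lemma wsum_eq:
  assumes "j \<ge> 1" "N \<ge> nat m"
  shows "wsum j m = (\<Sum>l\<le>N. real (part_count (m - int (j * l)) l))"
  unfolding wsum_def using assms part_count_far[OF assms(1)]
  by (intro sum.mono_neutral_left) auto

lemma vsum_eq:
  assumes "j \<ge> 1" "N \<ge> nat m"
  shows "vsum j m = (\<Sum>l\<le>N. real l * real (part_count (m - int (j * l)) l))"
  unfolding vsum_def using assms part_count_far[OF assms(1)]
  by (intro sum.mono_neutral_left) auto

lemma wsum_neg: "m < 0 \<Longrightarrow> wsum j m = 0"
  by (simp add: wsum_def part_count_neg)

lemma vsum_zero:
  assumes "m < int j" "j \<ge> 1" shows "vsum j m = 0"
  unfolding vsum_def
proof (rule sum.neutral, rule ballI)
  fix l
  show "real l * real (part_count (m - int (j * l)) l) = 0"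
  proof (cases "l = 0")
    case False
    then have "j \<le> j * l" by simp
    then have "int j \<le> int (j * l)" by (simp only: of_nat_le_iff)
    then have "m - int (j * l) < 0" using assms by linarith
    then show ?thesis by (simp only: part_count_neg of_nat_0 mult_zero_right)
  qed simp
qed

lemma part_count_shift:
  "part_count (m - int (Suc j * Suc i)) (Suc i) + part_count (m - int j - int (j * i)) i = part_count (m - int (j * Suc i)) (Suc i)"
  using part_count_Suc[of "m - int (j * Suc i)" i] by (simp add: algebra_simps)

lemma wsum_Suc:
  assumes "j \<ge> 1" shows "wsum (Suc j) m = wsum j m - wsum j (m - int j)"
proof -
  let ?N = "nat m"
  have "wsum (Suc j) m = (\<Sum>l\<le>Suc ?N. real (part_count (m - int (Suc j * l)) l))"
    using assms by (intro wsum_eq) auto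
  then have 1: "wsum (Suc j) m = real (part_count m 0) + (\<Sum>i\<le>?N. real (part_count (m - int (Suc j * Suc i)) (Suc i)))"
    by (simp only: sum.atMost_Suc_shift of_nat_0 mult_0_right mult_zero_left add_0 diff_0_right)
  have "wsum j m = (\<Sum>l\<le>Suc ?N. real (part_count (m - int (j * l)) l))"
    using assms by (intro wsum_eq) auto
  then have 2: "wsum j m = real (part_count m 0) + (\<Sum>i\<le>?N. real (part_count (m - int (j * Suc i)) (Suc i)))"
    by (simp only: sum.atMost_Suc_shift of_nat_0 mult_0_right mult_zero_left add_0 diff_0_right)
  have 3: "wsum j (m - int j) = (\<Sum>i\<le>?N. real (part_count (m - int j - int (j * i)) i))"
    using assms by (subst wsum_eq[of _ _ ?N]) auto
  show ?thesis unfolding 1 2 3 part_count_shift[of m j, symmetric] of_nat_add sum.distrib by simp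
qed

lemma vsum_Suc:
  assumes "j \<ge> 1"
  shows "vsum (Suc j) m = vsum j m - vsum j (m - int j) - wsum j (m - int j)"
proof -
  let ?N = "nat m"
  have "vsum (Suc j) m = (\<Sum>l\<le>Suc ?N. real l * real (part_count (m - int (Suc j * l)) l))"
    using assms by (intro vsum_eq) auto
  then have 1: "vsum (Suc j) m = (\<Sum>i\<le>?N. real (Suc i) * real (part_count (m - int (Suc j * Suc i)) (Suc i)))"
    by (simp only: sum.atMost_Suc_shift of_nat_0 mult_0_right mult_zero_left add_0 diff_0_right)
  have "vsum j m = (\<Sum>l\<le>Suc ?N. real l * real (part_count (m - int (j * l)) l))"
    using assms by (intro vsum_eq) auto
  then have 2: "vsum j m = (\<Sum>i\<le>?N. real (Suc i) * real (part_count (m - int (j * Suc i)) (Suc i)))"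
    by (simp only: sum.atMost_Suc_shift of_nat_0 mult_0_right mult_zero_left add_0 diff_0_right)
  have 3: "wsum j (m - int j) = (\<Sum>i\<le>?N. real (part_count (m - int j - int (j * i)) i))"
    using assms by (subst wsum_eq[of _ _ ?N]) auto
  have 4: "vsum j (m - int j) = (\<Sum>i\<le>?N. real i * real (part_count (m - int j - int (j * i)) i))"
    using assms by (subst vsum_eq[of _ _ ?N]) auto
  show ?thesis unfolding 1 2 3 4 sum_subtractf[symmetric]
  proof (rule sum.cong[OF refl])
    fix i
    have "real (part_count (m - int (j * Suc i)) (Suc i))
        = real (part_count (m - int (Suc j * Suc i)) (Suc i)) + real (part_count (m - int j - int (j * i)) i)"
      unfolding part_count_shift[of m j i, symmetric] by (rule of_nat_add)
    then show "real (Suc i) * real (part_count (m - int (Suc j * Suc i)) (Suc i)) =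
       real (Suc i) * real (part_count (m - int (j * Suc i)) (Suc i))
       - real i * real (part_count (m - int j - int (j * i)) i) - real (part_count (m - int j - int (j * i)) i)"
      by (simp only: of_nat_Suc) argo
  qed
qed

lemma part_count_eq_sum: "real (part_count m N) = (\<Sum>l\<le>N. real (part_count (m - int l) l))"
  by (induction N) (simp_all add: part_count_Suc[of m] del: of_nat_Suc)

lemma wsum_1: "N \<ge> nat m \<Longrightarrow> wsum 1 m = real (part_count m N)"
  by (subst wsum_eq[of _ _ N]) (simp_all add: part_count_eq_sum[of m N])

text \<open>
  With \<open>W\<close> and \<open>V\<close> for the generating functions, the recursions give
  \<open>V j / W j - V (j+1) / W (j+1) = z^j / (1 - z^j)\<close>; summation over \<open>j\<close> is this identity.  For \<open>j = 1\<close>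
  it equates the sum of the largest parts with the total number of parts.
\<close>

lemma vsum_convolution:
  assumes "j \<ge> 1" "m \<le> int N"
  shows "vsum j m = (\<Sum>a=j..N. \<Sum>b=1..N. wsum j (m - int (a * b)))"
proof -
  have "m \<le> int N \<Longrightarrow> vsum j m = (\<Sum>a=j..N. \<Sum>b=1..N. wsum j (m - int (a * b)))"
    if "nat m + (N + 1 - j) = d" "j \<ge> 1" for d j m
    using that
  proof (induction d arbitrary: j m rule: less_induct)
    case (less d)
    show ?case
    proof (cases "m < int j")
      case True
      have "wsum j (m - int (a * b)) = 0" if "a \<ge> j" "b \<ge> 1" for a b
      proof (rule wsum_neg)
        have "j * 1 \<le> a * b" using that by (intro mult_mono) auto
        then have "int j \<le> int (a * b)" by (simp only: of_nat_le_iff mult_1_right)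
        then show "m - int (a * b) < 0" using True by linarith
      qed
      then show ?thesis using vsum_zero[OF True] less by simp
    next
      case False
      let ?w = "\<lambda>j m a b. wsum j (m - int (a * b))"
      have jN: "j \<le> N" using False less by linarith
      have IH1: "vsum (Suc j) m = (\<Sum>a=Suc j..N. \<Sum>b=1..N. ?w (Suc j) m a b)"
        using jN less.prems by - (rule less.IH[OF _ _ refl]; auto)
      have IH2: "vsum j (m - int j) = (\<Sum>a=j..N. \<Sum>b=1..N. ?w j (m - int j) a b)"
        using jN less.prems False by - (rule less.IH[OF _ _ refl]; auto)
      \<comment> \<open>The difference of the convolutions at \<open>m\<close> and \<open>m - j\<close> is the one for \<open>j + 1\<close> plus its row \<open>a = j\<close>,
        and that row telescopes to \<open>wsum j (m - j)\<close>.\<close>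
      have "(\<Sum>a=j..N. \<Sum>b=1..N. ?w j m a b) - vsum j (m - int j)
            = (\<Sum>a=j..N. \<Sum>b=1..N. ?w (Suc j) m a b)"
        unfolding IH2 using less.prems
        by (simp add: wsum_Suc algebra_simps flip: sum_subtractf)
      also have "\<dots> = (\<Sum>b=1..N. ?w (Suc j) m j b) + vsum (Suc j) m"
        unfolding IH1 using jN by (subst sum.atLeast_Suc_atMost) auto
      also have "(\<Sum>b=1..N. ?w (Suc j) m j b)
                  = (\<Sum>b=1..N. wsum j (m - int (j * b)) - wsum j (m - int (j * Suc b)))"
        using less.prems by (intro sum.cong) (auto simp: wsum_Suc algebra_simps)
      also have "\<dots> = wsum j (m - int (j * 1)) - wsum j (m - int (j * Suc N))"
      proof -
        have "(\<Sum>b=1..N. wsum j (m - int (j * b)) - wsum j (m - int (j * Suc b)))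
            = - (\<Sum>b=1..N. wsum j (m - int (j * Suc b)) - wsum j (m - int (j * b)))"
          by (subst sum_negf[symmetric]) simp
        also have "\<dots> = - (wsum j (m - int (j * Suc N)) - wsum j (m - int (j * 1)))"
          by (subst sum_Suc_diff) (use jN less.prems in auto)
        finally show ?thesis by simp
      qed
      also have "wsum j (m - int (j * Suc N)) = 0"
      proof (rule wsum_neg)
        have "1 * Suc N \<le> j * Suc N" using less.prems by (intro mult_mono) auto
        then have "int (Suc N) \<le> int (j * Suc N)" by (simp only: of_nat_le_iff mult_1_left)
        then show "m - int (j * Suc N) < 0" using less.prems by linarith
      qed
      finally show ?thesis using vsum_Suc[of j m] less.prems by simp
    qed
  qed
  from this[OF refl assms] show ?thesis .
qed

lemma wsum_nonneg: "wsum j m \<ge> 0"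
  by (auto simp: wsum_def intro!: sum_nonneg)

lemma replicate_prefix:
  fixes ps :: "nat list"
  assumes "sorted_wrt (\<ge>) ps" "\<forall>x\<in>set ps. x \<le> l" "count_list ps l \<ge> j"
  shows "\<exists>qs. ps = replicate j l @ qs" 
  using assms
proof (induction j arbitrary: ps)
  case (Suc j)
  obtain x xs where ps: "ps = x # xs" using Suc.prems(3) by (cases ps) auto
  have "l \<in> set ps" using Suc.prems(3) by (metis count_notin not_less_eq_eq zero_le)
  then have "l \<le> x" using Suc.prems ps by auto
  moreover have "x \<le> l" using Suc.prems ps by auto
  ultimately have "x = l" by simp
  then show ?case using Suc.IH[of xs] Suc.prems ps by auto
qed simp

lemma count_list_replicate_self: "count_list (replicate j l) l = j"
  by (induction j) auto

text \<open>
  Removal of \<open>j\<close> copies of the largest part.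
\<close>

lemma partitions_largest_part:
  assumes "n \<ge> 1" "l \<ge> 1" "j \<ge> 1"
  shows "{ps \<in> partitions n. largest_part ps = l \<and> largest_part_mult ps \<ge> j}
         = (\<lambda>qs. replicate j l @ qs) ` bounded_partitions (int n - int (j * l)) l"
    (is "?A = ?B")
proof (intro equalityI subsetI)
  fix ps assume ps: "ps \<in> ?A"
  then have 1: "ps \<noteq> []" "sorted_wrt (\<ge>) ps" "\<forall>x\<in>set ps. x > 0" "sum_list ps = n"
      "hd ps = l" "count_list ps l \<ge> j"
    by (auto simp: partitions_def largest_part_mult_def largest_part_def)
  have 2: "\<forall>x\<in>set ps. x \<le> l" using 1 by (cases ps) auto
  obtain qs where qs: "ps = replicate j l @ qs" using replicate_prefix[OF 1(2) 2 1(6)] by blast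
  have "qs \<in> bounded_partitions (int n - int (j * l)) l"
  proof -
    have "sorted_wrt (\<ge>) qs" using 1(2) unfolding qs sorted_wrt_append by blast
    moreover have "set qs \<subseteq> set ps" unfolding qs set_append by (rule Un_upper2)
    then have "\<forall>x\<in>set qs. 0 < x \<and> x \<le> l" using 1(3) 2 by blast
    moreover have "j * l + sum_list qs = n" using 1(4) unfolding qs sum_list_append sum_list_replicate by simp
    then have "int (sum_list qs) = int n - int (j * l)" by linarith
    ultimately show ?thesis by (simp only: bounded_partitions_def mem_Collect_eq)
  qed
  then show "ps \<in> ?B" using qs by blast
next
  fix ps assume "ps \<in> ?B"
  then obtain qs where ps: "ps = replicate j l @ qs"
    and qs: "qs \<in> bounded_partitions (int n - int (j * l)) l" by blast
  have q: "sorted_wrt (\<ge>) qs" "\<forall>x\<in>set qs. 0 < x \<and> x \<le> l" "int (sum_list qs) = int n - int (j * l)"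
    using qs unfolding bounded_partitions_def mem_Collect_eq by blast+
  have hd: "hd ps = l" and ne: "ps \<noteq> []" using assms ps by (cases j; simp)+
  have "sorted_wrt (\<ge>) (replicate j l)"
    by (induction j) auto
  then have "sorted_wrt (\<ge>) ps" using q(2) unfolding ps sorted_wrt_append
    by (auto simp: q(1))
  moreover have "\<forall>x\<in>set ps. x > 0" using q(2) assms unfolding ps by auto
  moreover have "sum_list ps = n"
    using q(3) unfolding ps sum_list_append sum_list_replicate of_nat_id by linarith
  moreover have "count_list ps l \<ge> j"
    unfolding ps by (simp add: count_list_replicate_self)
  ultimately show "ps \<in> ?A"
    using hd ne by (simp add: partitions_def largest_part_mult_def largest_part_def)
qed

lemma sum_partitions_largest_part:
  fixes g :: "nat \<Rightarrow> real"
  assumes "n \<ge> 1" "j \<ge> 1"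
  shows "(\<Sum>ps | ps \<in> partitions n \<and> largest_part_mult ps \<ge> j. g (largest_part ps))
         = (\<Sum>l\<le>n. g l * real (part_count (int n - int (j * l)) l))"
proof -
  let ?S = "{ps. ps \<in> partitions n \<and> largest_part_mult ps \<ge> j}"
  have fin: "finite ?S" using finite_partitions[of n] by simp
  have L: "largest_part ps \<in> {1..n}" if "ps \<in> partitions n" for ps
  proof -
    have "ps \<noteq> []" "\<forall>x\<in>set ps. x > 0" "sum_list ps = n" using that by (auto simp: partitions_def)
    then show ?thesis by (cases ps) (auto simp: largest_part_def)
  qed
  have "(\<Sum>ps\<in>?S. g (largest_part ps)) = (\<Sum>l\<le>n. \<Sum>ps | ps \<in> ?S \<and> largest_part ps = l. g (largest_part ps))"
    using L fin by (subst sum.group) (auto simp: image_subset_iff)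
  also have "\<dots> = (\<Sum>l\<le>n. g l * real (part_count (int n - int (j * l)) l))"
  proof (rule sum.cong[OF refl])
    fix l
    have "(\<Sum>ps | ps \<in> ?S \<and> largest_part ps = l. g (largest_part ps))
          = g l * real (card {ps \<in> ?S. largest_part ps = l})"
      by simp
    also have "card {ps \<in> ?S. largest_part ps = l} = part_count (int n - int (j * l)) l"
    proof (cases "l = 0")
      case True
      have "{ps \<in> ?S. largest_part ps = l} = {}" using L True by fastforce
      then have "card {ps \<in> ?S. largest_part ps = l} = 0" by (simp only: card.empty)
      then show ?thesis using True assms by (simp add: part_count_zero)
    next
      case False
      have eq: "{ps \<in> ?S. largest_part ps = l} =
            {ps \<in> partitions n. largest_part ps = l \<and> largest_part_mult ps \<ge> j}" by auto
      show ?thesis unfolding eq part_count_def using False assms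
        by (subst partitions_largest_part) (auto intro!: card_image inj_onI)
    qed
    finally show "(\<Sum>ps | ps \<in> ?S \<and> largest_part ps = l. g (largest_part ps)) = g l * real (part_count (int n - int (j * l)) l)" .
  qed
  finally show ?thesis .
qed

lemma card_mult_ge:
  assumes "n \<ge> 1" "j \<ge> 1"
  shows "real (card {ps \<in> partitions n. largest_part_mult ps \<ge> j}) = wsum j (int n)"
  using sum_partitions_largest_part[OF assms, of "\<lambda>_. 1"] by (simp add: wsum_def)

lemma sum_largest_mult_ge:
  assumes "n \<ge> 1" "j \<ge> 1"
  shows "(\<Sum>ps | ps \<in> partitions n \<and> largest_part_mult ps \<ge> j. real (largest_part ps)) = vsum j (int n)"
  using sum_partitions_largest_part[OF assms, of real] by (simp add: vsum_def)

lemma largest_part_mult_pos: "ps \<in> partitions n \<Longrightarrow> largest_part_mult ps \<ge> 1"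
  by (cases ps) (auto simp: partitions_def largest_part_mult_def largest_part_def)

lemma card_partitions: "n \<ge> 1 \<Longrightarrow> real (card (partitions n)) = wsum 1 (int n)"
  using card_mult_ge[of n 1] largest_part_mult_pos by (simp add: Collect_conj_eq Int_absorb2 subset_iff)

lemma largest_times_mult_le:
  assumes "ps \<in> partitions n" shows "largest_part ps * largest_part_mult ps \<le> n"
proof -
  have "count_list ps x * x \<le> sum_list ps" for x
    by (induction ps) auto
  then show ?thesis using assms by (auto simp: partitions_def largest_part_mult_def mult.commute)
qed

text \<open>
  Here \<open>L (M - 1) = L [M \<ge> 2] + L (M - 2) [M \<ge> 3]\<close>, and the last summand is \<open>L\<close> if \<open>M = 3\<close> and
  at most \<open>L M \<le> n\<close> if \<open>M \<ge> 4\<close>.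
\<close>

lemma expectation_excess:
  assumes "n \<ge> 1"
  defines "E \<equiv> measure_pmf.expectation (random_partition n)"
  defines "d \<equiv> E (\<lambda>ps. real (largest_part ps) * real (largest_part_mult ps))
        - E (\<lambda>ps. real (largest_part ps))"
  shows "vsum 2 n / wsum 1 n \<le> d"
    and "d \<le> (vsum 2 n + vsum 3 n + real n * wsum 4 n) / wsum 1 n"
proof -
  let ?P = "partitions n"
  let ?L = "\<lambda>ps. real (largest_part ps)" and ?M = "\<lambda>ps. real (largest_part_mult ps)"
  have fin: "finite ?P" by (rule finite_partitions)
  have E: "E f = (\<Sum>ps\<in>?P. f ps) / wsum 1 n" for f
    unfolding E_def random_partition_def
    using assms partitions_nonempty[OF assms(1)]
    by (subst integral_pmf_of_set) (auto simp: fin card_partitions)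
  have d: "d = (\<Sum>ps\<in>?P. ?L ps * (?M ps - 1)) / wsum 1 n"
    unfolding d_def E by (simp add: algebra_simps sum_subtractf diff_divide_distrib)
  have v: "vsum j n = (\<Sum>ps\<in>?P. if largest_part_mult ps \<ge> j then ?L ps else 0)" if "j \<ge> 1" for j
    using that sum_largest_mult_ge[OF assms(1) that]
    by (simp add: sum.inter_filter[OF fin, symmetric])
  have w: "wsum 4 n = (\<Sum>ps\<in>?P. if largest_part_mult ps \<ge> 4 then 1 else 0)"
    using card_mult_ge[OF assms(1), of 4]
    by (simp add: sum.inter_filter[OF fin, symmetric])
  show "vsum 2 n / wsum 1 n \<le> d" unfolding d
  proof (intro divide_right_mono wsum_nonneg)
    show "vsum 2 n \<le> (\<Sum>ps\<in>?P. ?L ps * (?M ps - 1))"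
      unfolding v[of 2, simplified] using largest_part_mult_pos
      by (intro sum_mono) (auto simp: mult_le_cancel_left1 intro!: mult_nonneg_nonneg)
  qed
  show "d \<le> (vsum 2 n + vsum 3 n + real n * wsum 4 n) / wsum 1 n" unfolding d
  proof (intro divide_right_mono wsum_nonneg)
    have "?L ps * (?M ps - 1) \<le> (if largest_part_mult ps \<ge> 2 then ?L ps else 0)
       + (if largest_part_mult ps \<ge> 3 then ?L ps else 0)
       + real n * (if largest_part_mult ps \<ge> 4 then 1 else 0)" if "ps \<in> ?P" for ps
    proof -
      have "?L ps * ?M ps \<le> real n"
        using largest_times_mult_le[OF that] by (metis of_nat_le_iff of_nat_mult)
      moreover have "largest_part_mult ps = 1 \<or> largest_part_mult ps = 2
        \<or> largest_part_mult ps = 3 \<or> largest_part_mult ps \<ge> 4"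
        using largest_part_mult_pos[OF that] by linarith
      ultimately show ?thesis by (elim disjE) (auto simp: algebra_simps)
    qed
    then show "(\<Sum>ps\<in>?P. ?L ps * (?M ps - 1)) \<le> vsum 2 n + vsum 3 n + real n * wsum 4 n"
      unfolding v[of 2, simplified] v[of 3, simplified] w
      by (simp add: sum_distrib_left flip: sum.distrib) (intro sum_mono, simp)
  qed
qed

section \<open>Fourier representation of partition numbers\<close>

text \<open>
  The mean of the geometric variable with ratio \<open>exp (-k s)\<close>: the expected multiplicity of the part \<open>k\<close>
  in a random partition of random size, weighted by \<open>exp (-s)\<close> to the size.
\<close>

definition mean_mult :: "real \<Rightarrow> nat \<Rightarrow> real" where
  "mean_mult s k = 1 / (exp (real k * s) - 1)"

text \<open>
  The characteristic function at \<open>a\<close> of the geometric variable on the natural numbers with mean \<open>m\<close>.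
\<close>

definition geo_char :: "real \<Rightarrow> real \<Rightarrow> complex" where
  "geo_char m a = 1 / (1 - of_real m * (cis a - 1))"

text \<open>
  The characteristic function of the size of the random partition with independent geometric
  multiplicities of the parts \<open>1, ..., N\<close>.
\<close>

definition size_char :: "real \<Rightarrow> nat \<Rightarrow> real \<Rightarrow> complex" where
  "size_char s N t = (\<Prod>k=1..N. geo_char (mean_mult s k) (real k * t))"

text \<open>
  The generating function of partitions into parts at most \<open>N\<close>, at \<open>exp (-s)\<close>.
\<close>

definition part_gf :: "real \<Rightarrow> nat \<Rightarrow> real" where
  "part_gf s N = (\<Prod>k=1..N. 1 / (1 - exp (- real k * s)))"

lemma mean_mult_pos: "s > 0 \<Longrightarrow> k \<ge> 1 \<Longrightarrow> mean_mult s k > 0"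
  by (simp add: mean_mult_def)

lemma mean_mult_nonneg: "s > 0 \<Longrightarrow> mean_mult s k \<ge> 0"
  by (simp add: mean_mult_def)

lemma geo_char_denom: "cmod (1 - of_real m * (cis a - 1)) ^ 2 = 1 + 2 * m * (1 + m) * (1 - cos a)"
proof -
  have "cmod (1 - of_real m * (cis a - 1)) ^ 2 = (1 - m * (cos a - 1))^2 + (m * sin a)^2"
    by (simp add: cmod_power2)
  also have "\<dots> = (1 - m * (cos a - 1))^2 + m^2 * (1 - (cos a)^2)"
    by (simp add: power_mult_distrib sin_squared_eq)
  also have "\<dots> = 1 + 2 * m * (1 + m) * (1 - cos a)"
    by algebra
  finally show ?thesis .
qed

lemma geo_char_denom_ge: assumes "m \<ge> 0" shows "cmod (1 - of_real m * (cis a - 1)) \<ge> 1"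
proof -
  have "2 * m * (1 + m) * (1 - cos a) \<ge> 0" using assms by simp
  then have "1 \<le> cmod (1 - of_real m * (cis a - 1)) ^ 2" unfolding geo_char_denom by simp
  then show ?thesis by (metis norm_ge_zero one_power2 power2_le_imp_le)
qed

lemma norm_geo_char_sq: "cmod (geo_char m a) ^ 2 = 1 / (1 + 2 * m * (1 + m) * (1 - cos a))"
  unfolding geo_char_def norm_divide power_divide geo_char_denom by simp

lemma norm_geo_char_le: "m \<ge> 0 \<Longrightarrow> cmod (geo_char m a) \<le> 1"
  using geo_char_denom_ge[of m a] unfolding geo_char_def norm_divide by (simp add: divide_le_eq_1)

lemma continuous_geo_char [continuous_intros]:
  assumes "continuous_on A f" "m \<ge> 0"
  shows "continuous_on A (\<lambda>x. geo_char m (f x))"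
proof -
  have "1 - of_real m * (cis (f x) - 1) \<noteq> 0" for x
    using geo_char_denom_ge[OF assms(2), of "f x"] by fastforce
  then show ?thesis unfolding geo_char_def using assms(1) by (intro continuous_intros) auto
qed

lemma continuous_size_char [continuous_intros]:
  assumes "s > 0" "continuous_on A f"
  shows "continuous_on A (\<lambda>x. size_char s N (f x))"
  unfolding size_char_def using assms
  by (intro continuous_intros) (auto intro: mean_mult_nonneg)

lemma norm_size_char_le: "s > 0 \<Longrightarrow> cmod (size_char s N t) \<le> 1"
  unfolding size_char_def prod_norm[symmetric]
  by (intro prod_le_1) (auto intro!: norm_geo_char_le mean_mult_nonneg)

lemma size_char_Suc:
  fixes N :: nat
  assumes "s > 0"
  defines "y \<equiv> exp (- real (Suc N) * s)"
  shows "size_char s (Suc N) t = of_real (1 - y) * size_char s N t + of_real y * cis (real (Suc N) * t) * size_char s (Suc N) t"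
proof -
  let ?m = "mean_mult s (Suc N)" and ?c = "cis (real (Suc N) * t)"
  have y: "0 < y" "y < 1" using assms by (simp_all add: y_def mult_neg_pos)
  have "?m = y / (1 - y)"
  proof -
    have "exp (real (Suc N) * s) > 1" using assms by (simp del: of_nat_Suc)
    moreover have "y = inverse (exp (real (Suc N) * s))"
      unfolding y_def by (simp add: exp_minus del: of_nat_Suc)
    moreover have "1 / (E - 1) = inverse E / (1 - inverse E)" if "E > 1" for E :: real
      using that by (simp add: field_simps)
    ultimately show ?thesis unfolding mean_mult_def by simp
  qed
  then have "?m * (1 - y) = y" using y by simp
  then have m: "complex_of_real ?m * of_real (1 - y) = of_real y"
    by (simp only: of_real_mult[symmetric])
  have "(1 - of_real ?m * (?c - 1)) * of_real (1 - y)
      = of_real (1 - y) - (of_real ?m * of_real (1 - y)) * (?c - 1)"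
    by (simp only: algebra_simps mult_1_left)
  then have "(1 - of_real ?m * (?c - 1)) * of_real (1 - y) = 1 - of_real y * ?c"
    unfolding m by (simp add: algebra_simps)
  moreover have "geo_char ?m (real (Suc N) * t) * (1 - of_real ?m * (?c - 1)) = 1"
    using geo_char_denom_ge[of ?m "real (Suc N) * t"] mean_mult_pos[OF assms(1), of "Suc N"]
    unfolding geo_char_def by fastforce
  ultimately have "geo_char ?m (real (Suc N) * t) * (1 - of_real y * ?c) = of_real (1 - y)"
    by (metis mult.assoc mult_1)
  then have "size_char s (Suc N) t * (1 - of_real y * ?c) = of_real (1 - y) * size_char s N t"
    by (simp add: size_char_def mult.assoc del: of_nat_Suc)
  then show ?thesis by (simp add: algebra_simps del: of_nat_Suc)
qed

text \<open>
  The (unnormalised) Fourier coefficient of \<open>size_char\<close> at the integer \<open>m\<close>.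
\<close>

definition fourier_coeff :: "real \<Rightarrow> nat \<Rightarrow> int \<Rightarrow> complex" where
  "fourier_coeff s N m = integral {-pi..pi} (\<lambda>t. cis (- of_int m * t) * size_char s N t)"

lemma fourier_coeff_integrable:
  "s > 0 \<Longrightarrow> (\<lambda>t. cis (- of_int m * t) * size_char s N t) integrable_on {-pi..pi}"
  by (intro integrable_continuous_interval continuous_intros) auto

lemma fourier_coeff_Suc:
  fixes N :: nat
  assumes "s > 0"
  defines "y \<equiv> exp (- real (Suc N) * s)"
  shows "fourier_coeff s (Suc N) m = of_real (1 - y) * fourier_coeff s N m + of_real y * fourier_coeff s (Suc N) (m - int (Suc N))"
proof -
  have "cis (- of_int m * t) * size_char s (Suc N) t =
     of_real (1 - y) * (cis (- of_int m * t) * size_char s N t)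
     + of_real y * (cis (- of_int (m - int (Suc N)) * t) * size_char s (Suc N) t)" for t
  proof -
    have "cis (- of_int (m - int (Suc N)) * t) = cis (- of_int m * t) * cis (real (Suc N) * t)"
      by (simp add: cis_mult algebra_simps)
    then show ?thesis
      by (subst size_char_Suc[OF assms(1)]) (simp add: y_def algebra_simps del: of_nat_Suc)
  qed
  then show ?thesis unfolding fourier_coeff_def
    using fourier_coeff_integrable[OF assms(1)]
    by (simp add: integral_add integrable_on_cmult_left del: of_nat_Suc of_int_diff of_real_diff)
qed

lemma norm_fourier_coeff_le: assumes "s > 0" shows "cmod (fourier_coeff s N m) \<le> 2 * pi"
proof -
  have "cmod (fourier_coeff s N m) \<le> integral {-pi..pi} (\<lambda>_. 1::real)"
    unfolding fourier_coeff_def using assms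
    by (intro integral_norm_bound_integral fourier_coeff_integrable) (auto simp: norm_mult norm_size_char_le)
  then show ?thesis by simp
qed

lemma integral_cis:
  "integral {-pi..pi} (\<lambda>t. cis (- (of_int m * t))) = (if m = 0 then 2 * of_real pi else 0)"
proof (cases "m = 0")
  case False
  let ?F = "\<lambda>t::real. cis (- of_int m * t) * (\<i> / of_int m)"
  have "((\<lambda>t. cis (- of_int m * t)) has_integral (?F pi - ?F (-pi))) {-pi..pi}"
  proof (rule fundamental_theorem_of_calculus)
    fix t :: real
    have "((\<lambda>z. exp (\<i> * (- of_int m * z)) * (\<i> / of_int m)) has_field_derivative
        exp (\<i> * (- of_int m * of_real t))) (at (of_real t))"
      using False by (auto intro!: derivative_eq_intros simp: field_simps)
    from has_vector_derivative_real_field[OF this]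
    show "(?F has_vector_derivative cis (- of_int m * t)) (at t within {-pi..pi})"
      by (simp add: cis_conv_exp)
  qed auto
  moreover have "?F pi = ?F (-pi)"
  proof -
    have "sin (pi * of_int m) = 0" by (simp add: sin_times_pi_eq_0)
    then have "cis (- of_int m * pi) = cis (- of_int m * (- pi))"
      by (simp add: cis.code complex_eq_iff mult.commute)
    then show ?thesis by simp
  qed
  ultimately show ?thesis using False by (simp add: integral_unique)
qed (simp add: scaleR_conv_of_real)

text \<open>
  The recursion in \<open>m\<close> shifts to \<open>m - b (N+1)\<close> with a factor that decays geometrically in \<open>b\<close>, while all
  coefficients are bounded.  This replaces the power series expansion.
\<close>

lemma fourier_coeff_neg: assumes "s > 0" "m < 0" shows "fourier_coeff s N m = 0"
  using assms(2)
proof (induction N arbitrary: m)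
  case 0
  then show ?case unfolding fourier_coeff_def by (simp add: size_char_def integral_cis)
next
  case (Suc N)
  let ?y = "exp (- real (Suc N) * s)"
  have y: "0 < ?y" "?y < 1" using assms by (simp_all add: mult_neg_pos del: of_nat_Suc)
  have step: "fourier_coeff s (Suc N) m = of_real ?y * fourier_coeff s (Suc N) (m - int (Suc N))" if "m < 0" for m
    using fourier_coeff_Suc[OF assms(1), of N m] Suc.IH[OF that] by simp
  have iter: "fourier_coeff s (Suc N) m = of_real (?y ^ b) * fourier_coeff s (Suc N) (m - int (b * Suc N))" for b
  proof (induction b)
    case (Suc b)
    have "m - int (b * Suc N) < 0" using \<open>m < 0\<close> by (simp add: add_strict_increasing2 del: mult_Suc_right of_nat_mult)
    moreover have "m - int (Suc b * Suc N) = m - int (b * Suc N) - int (Suc N)"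
      by simp
    ultimately show ?case using Suc step[of "m - int (b * Suc N)"]
      by (simp only: power_Suc of_real_mult) (simp only: ac_simps)
  qed simp
  have "cmod (fourier_coeff s (Suc N) m) \<le> ?y ^ b * (2 * pi)" for b
    by (subst iter[of b]) (auto simp: norm_mult norm_power norm_fourier_coeff_le assms simp del: of_nat_Suc intro!: mult_left_mono)
  moreover have "(\<lambda>b. ?y ^ b * (2 * pi)) \<longlonglongrightarrow> 0"
    using y by (intro tendsto_mult_left_zero LIMSEQ_power_zero) auto
  ultimately have "cmod (fourier_coeff s (Suc N) m) \<le> 0"
    using LIMSEQ_le_const by blast
  then show ?case by simp
qed

lemma part_gf_Suc: "part_gf s (Suc N) = part_gf s N / (1 - exp (- real (Suc N) * s))"
  by (simp add: part_gf_def del: of_nat_Suc)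

lemma part_gf_pos: "s > 0 \<Longrightarrow> part_gf s N > 0"
  unfolding part_gf_def by (intro prod_pos) auto

text \<open>
  Both sides satisfy the recursion of \<open>part_count_Suc\<close>, so no interchange of integral and infinite sum
  is necessary.
\<close>

lemma fourier_part_count:
  assumes "s > 0"
  shows "of_real (2 * pi * real (part_count m N)) = of_real (exp (of_int m * s) * part_gf s N) * fourier_coeff s N m"
proof (induction N arbitrary: m)
  case 0
  show ?case by (simp add: part_count_zero fourier_coeff_def size_char_def part_gf_def integral_cis)
next
  case (Suc N)
  let ?y = "exp (- real (Suc N) * s)"
  have y: "0 < ?y" "?y < 1" using assms by (simp_all add: mult_neg_pos del: of_nat_Suc)
  show ?case
  proof (cases "m < 0")
    case True
    then show ?thesis by (simp add: part_count_neg fourier_coeff_neg assms)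
  next
    case False
    then have "m \<ge> 0" by simp
    then show ?thesis
    proof (induction "nat m" arbitrary: m rule: less_induct)
      case less
      have *: "of_real (2 * pi * real (part_count (m - int (Suc N)) (Suc N)))
          = complex_of_real (exp (of_int (m - int (Suc N)) * s) * part_gf s (Suc N)) * fourier_coeff s (Suc N) (m - int (Suc N))"
      proof (cases "m < int (Suc N)")
        case True
        then show ?thesis by (simp add: part_count_neg fourier_coeff_neg assms)
      next
        case False
        then show ?thesis by (intro less.hyps) auto
      qed
      have e: "exp (of_int (m - int (Suc N)) * s) = exp (of_int m * s) * ?y"
        by (simp add: exp_add[symmetric] algebra_simps)
      have g: "part_gf s N = part_gf s (Suc N) * (1 - ?y)"
      proof -
        have "1 - ?y \<noteq> 0" using y by linarith
        moreover have "a = a / b * b" if "b \<noteq> 0" for a b :: real using that by simp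
        ultimately show ?thesis unfolding part_gf_Suc by blast
      qed
      have "of_real (2 * pi * real (part_count m (Suc N)))
         = of_real (2 * pi * real (part_count m N)) + complex_of_real (2 * pi * real (part_count (m - int (Suc N)) (Suc N)))"
        unfolding part_count_Suc[of m] by (simp only: of_nat_add distrib_left of_real_add)
      also have "\<dots> = of_real (exp (of_int m * s) * part_gf s (Suc N)) *
          (of_real (1 - ?y) * fourier_coeff s N m + of_real ?y * fourier_coeff s (Suc N) (m - int (Suc N)))"
        unfolding * Suc.IH e g by (simp add: algebra_simps del: of_nat_Suc)
      finally show ?case by (subst fourier_coeff_Suc[OF assms])
    qed
  qed
qed

text \<open>
  The value at \<open>exp (-s + i t)\<close> of the polynomial \<open>(1 - z) ... (1 - z^(j-1))\<close>, by which the generating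
  function of \<open>wsum j\<close> differs from that of \<open>wsum 1\<close>.
\<close>

definition gap_factor :: "real \<Rightarrow> nat \<Rightarrow> real \<Rightarrow> complex" where
  "gap_factor s j t = (\<Prod>i=1..<j. 1 - of_real (exp (- real i * s)) * cis (real i * t))"

lemma continuous_gap_factor [continuous_intros]:
  "continuous_on A f \<Longrightarrow> continuous_on A (\<lambda>x. gap_factor s j (f x))"
  unfolding gap_factor_def by (intro continuous_intros)

lemma fourier_wsum:
  assumes "s > 0" "j \<ge> 1" "m \<le> int N"
  shows "of_real (2 * pi * wsum j m) = of_real (exp (of_int m * s) * part_gf s N) *
           integral {-pi..pi} (\<lambda>t. cis (- of_int m * t) * size_char s N t * gap_factor s j t)"
  using assms(2,3)
proof (induction j arbitrary: m rule: nat_induct_at_least)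
  case base
  then show ?case using fourier_part_count[OF assms(1), of m N] wsum_1[of m N]
    by (simp add: gap_factor_def fourier_coeff_def)
next
  case (Suc j)
  let ?f = "\<lambda>m t. cis (- of_int m * t) * size_char s N t * gap_factor s j t"
  let ?y = "exp (- real j * s)"
  have int: "?f m integrable_on {-pi..pi}" for m :: int
    using assms(1) by (intro integrable_continuous_interval continuous_intros) auto
  have "cis (- of_int m * t) * size_char s N t * gap_factor s (Suc j) t
        = ?f m t - of_real ?y * ?f (m - int j) t" for t
  proof -
    have 1: "cis (- of_int (m - int j) * t) = cis (- of_int m * t) * cis (real j * t)"
      by (simp add: cis_mult algebra_simps)
    have 2: "gap_factor s (Suc j) t = gap_factor s j t * (1 - of_real ?y * cis (real j * t))"
      using Suc.hyps by (simp add: gap_factor_def)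
    show ?thesis unfolding 1 2 by (simp only: algebra_simps mult_1_left)
  qed
  then have I: "integral {-pi..pi} (\<lambda>t. cis (- of_int m * t) * size_char s N t * gap_factor s (Suc j) t)
      = integral {-pi..pi} (?f m) - of_real ?y * integral {-pi..pi} (?f (m - int j))"
    using int by (simp add: integral_diff integrable_on_cmult_left del: of_int_diff)
  have e: "exp (of_int (m - int j) * s) = exp (of_int m * s) * ?y"
    by (simp add: exp_add[symmetric] algebra_simps)
  have "complex_of_real (2 * pi * wsum (Suc j) m)
      = of_real (2 * pi * wsum j m) - of_real (2 * pi * wsum j (m - int j))"
    using Suc.hyps by (simp add: wsum_Suc algebra_simps)
  also have "\<dots> = of_real (exp (of_int m * s) * part_gf s N) * (integral {-pi..pi} (?f m) - of_real ?y * integral {-pi..pi} (?f (m - int j)))"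
    using Suc.prems by (subst Suc.IH, simp, subst Suc.IH, simp, subst e) (simp add: algebra_simps)
  finally show ?case unfolding I .
qed

section \<open>Decay of the characteristic function\<close>

lemma abs_sin_ge: fixes x :: real assumes "\<bar>x\<bar> \<le> 2" shows "\<bar>sin x\<bar> \<ge> \<bar>x\<bar> / 3"
proof -
  have "\<bar>sin x - (\<Sum>m<3. sin_coeff m * x ^ m)\<bar> \<le> inverse (fact 3) * \<bar>x\<bar> ^ 3"
    by (rule Maclaurin_sin_bound)
  moreover have "(\<Sum>m<3. sin_coeff m * x ^ m) = x"
    by (simp add: sin_coeff_def eval_nat_numeral)
  moreover have "inverse (fact 3) * \<bar>x\<bar> ^ 3 = \<bar>x\<bar> * \<bar>x\<bar>^2 / 6"
    by (simp add: fact_numeral power3_eq_cube power2_eq_square)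
  moreover have "\<bar>x\<bar> * \<bar>x\<bar>^2 \<le> \<bar>x\<bar> * 4"
    using power_mono[OF assms, of 2] by (intro mult_left_mono) auto
  ultimately show ?thesis by linarith
qed

lemma one_minus_cos_ge: fixes u :: real assumes "\<bar>u\<bar> \<le> 4" shows "1 - cos u \<ge> u^2 / 18"
proof -
  have "(\<bar>u\<bar> / 6)^2 \<le> \<bar>sin (u/2)\<bar>^2"
    using abs_sin_ge[of "u/2"] assms by (intro power_mono) auto
  then have "u^2 / 36 \<le> (sin (u/2))^2" by (simp add: power_divide)
  moreover have "cos u = 1 - 2 * (sin (u/2))^2" using cos_double_sin[of "u/2"] by simp
  ultimately show ?thesis by linarith
qed

lemma dirichlet_kernel:
  fixes t :: real
  shows "2 * sin (t/2) * (\<Sum>k=1..K. cos (real k * t)) = sin ((real K + 1/2) * t) - sin (t/2)"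
proof (induction K)
  case (Suc K)
  have "2 * sin (t/2) * cos (real (Suc K) * t) = sin ((real (Suc K) + 1/2) * t) - sin ((real K + 1/2) * t)"
  proof -
    have "(real (Suc K) + 1/2) * t = real (Suc K) * t + t/2" "(real K + 1/2) * t = real (Suc K) * t - t/2"
      by (simp_all add: algebra_simps)
    then show ?thesis by (simp only: sin_add sin_diff) (simp add: algebra_simps del: of_nat_Suc)
  qed
  then show ?case using Suc by (simp add: distrib_left del: of_nat_Suc)
qed simp

text \<open>
  By the Dirichlet kernel, the cosine sum is at most \<open>3 / |t|\<close>, hence at most \<open>3 K / 4\<close>.
\<close>

lemma sum_one_minus_cos_large:
  fixes t :: real
  assumes "\<bar>t\<bar> \<le> pi" "real K * \<bar>t\<bar> \<ge> 4"
  shows "(\<Sum>k=1..K. 1 - cos (real k * t)) \<ge> real K / 4"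
proof -
  let ?D = "\<Sum>k=1..K. cos (real k * t)"
  have t: "\<bar>t\<bar> > 0" using assms by (cases "t = 0") auto
  have s: "\<bar>sin (t/2)\<bar> \<ge> \<bar>t\<bar> / 6" using abs_sin_ge[of "t/2"] assms pi_less_4 by simp
  have eq: "2 * sin (t/2) * (?D + 1/2) = sin ((real K + 1/2) * t)"
    using dirichlet_kernel[of t K] by (simp add: algebra_simps)
  have "2 * (\<bar>t\<bar> / 6) * \<bar>?D + 1/2\<bar> \<le> 2 * \<bar>sin (t/2)\<bar> * \<bar>?D + 1/2\<bar>"
    using s by (intro mult_right_mono) auto
  also have "\<dots> = \<bar>2 * sin (t/2) * (?D + 1/2)\<bar>" by (simp add: abs_mult)
  also have "\<dots> \<le> 1" unfolding eq by (rule abs_sin_le_one)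
  finally have "\<bar>t\<bar> * \<bar>?D + 1/2\<bar> \<le> \<bar>t\<bar> * (3/4 * real K)" using assms(2)
    by (simp add: mult.commute)
  then have "\<bar>?D + 1/2\<bar> \<le> 3/4 * real K" using t by simp
  then have "?D \<le> 3/4 * real K" by linarith
  then show ?thesis by (simp add: sum_subtractf)
qed

lemma sum_one_minus_cos_small:
  fixes t :: real
  assumes "real K * \<bar>t\<bar> \<le> 4"
  shows "(\<Sum>k=1..K. 1 - cos (real k * t)) \<ge> real K ^ 3 * t^2 / 54"
proof -
  have sq: "real K ^ 3 / 3 \<le> (\<Sum>k=1..K. (real k)^2)"
  proof (induction K)
    case (Suc K)
    have "real (Suc K) ^ 3 = real K ^ 3 + 3 * real K ^ 2 + 3 * real K + 1"
      by (simp add: power3_eq_cube power2_eq_square algebra_simps)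
    moreover have "real (Suc K)^2 = real K ^ 2 + 2 * real K + 1"
      by (simp add: power2_eq_square algebra_simps)
    ultimately show ?case using Suc by simp
  qed simp
  have "real K ^ 3 * t^2 / 54 = real K ^ 3 / 3 * (t^2 / 18)" by simp
  also have "\<dots> \<le> (\<Sum>k=1..K. (real k)^2) * (t^2 / 18)" by (intro mult_right_mono sq) auto
  also have "\<dots> = (\<Sum>k=1..K. (real k * t)^2 / 18)"
    by (simp add: sum_distrib_right power_mult_distrib)
  also have "\<dots> \<le> (\<Sum>k=1..K. 1 - cos (real k * t))"
  proof (intro sum_mono one_minus_cos_ge)
    fix k assume "k \<in> {1..K}"
    then have "real k * \<bar>t\<bar> \<le> real K * \<bar>t\<bar>" by (intro mult_right_mono) auto
    then show "\<bar>real k * t\<bar> \<le> 4" using assms by (simp add: abs_mult)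
  qed
  finally show ?thesis .
qed

text \<open>
  The hypothesis says that the variance \<open>m (1 + m)\<close> is bounded below.
\<close>

lemma norm_geo_char_le_exp:
  assumes "m \<ge> 0" "m * (1 + m) \<ge> 1/3"
  shows "cmod (geo_char m a) \<le> exp (- (1 - cos a) / 8)"
proof -
  let ?w = "1 - cos a"
  have w: "0 \<le> ?w" "?w \<le> 2" using cos_ge_minus_one[of a] by auto
  have "exp (?w / 4) \<le> 1 + 2/3 * ?w"
  proof -
    have "1 - ?w/4 \<le> exp (- (?w / 4))" using exp_ge_add_one_self[of "- (?w/4)"] by simp
    then have "exp (?w/4) * (1 - ?w / 4) \<le> exp (?w/4) * exp (- (?w / 4))" by (intro mult_left_mono) auto
    then have "exp (?w/4) * (1 - ?w / 4) \<le> 1" by (simp add: exp_minus)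
    moreover have "1 \<le> (1 + 2/3 * ?w) * (1 - ?w/4)"
    proof -
      have "(1 + 2/3 * ?w) * (1 - ?w/4) = 1 + ?w * (5/12 - ?w / 6)" by (simp add: field_simps)
      moreover have "?w / 6 \<le> 5/12" using divide_right_mono[OF w(2), of 6] by (rule order_trans) simp_all
      then have "5/12 - ?w / 6 \<ge> 0" by (simp only: diff_ge_0_iff_ge)
      then have "?w * (5/12 - ?w / 6) \<ge> 0" using w(1) by (rule mult_nonneg_nonneg[rotated])
      ultimately show ?thesis by simp
    qed
    ultimately have "exp (?w/4) * (1 - ?w / 4) \<le> (1 + 2/3 * ?w) * (1 - ?w/4)" by linarith
    then show ?thesis using w by (simp add: mult_le_cancel_right)
  qed
  also have "\<dots> \<le> 1 + 2 * m * (1 + m) * ?w"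
    using mult_right_mono[OF assms(2) w(1)] by simp
  finally have "cmod (geo_char m a) ^ 2 \<le> 1 / exp (?w / 4)"
    unfolding norm_geo_char_sq by (intro divide_left_mono) (auto intro!: mult_pos_pos simp: add_pos_nonneg assms)
  also have "1 / exp (?w / 4) = exp (- ?w / 8) ^ 2"
  proof -
    have "1 / exp (x / 4) = exp (- x / 8) ^ 2" for x :: real
    proof -
      have "- x / 8 + - x / 8 = - (x / 4)" by simp
      then show ?thesis
        by (simp only: power2_eq_square exp_add[symmetric] exp_minus inverse_eq_divide)
    qed
    then show ?thesis .
  qed
  finally show ?thesis by (rule power2_le_imp_le) simp
qed

lemma mean_mult_variance_ge:
  assumes "s > 0" "k \<ge> 1" "real k * s \<le> 1"
  shows "mean_mult s k * (1 + mean_mult s k) \<ge> 1/3"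
proof -
  define E where "E = exp (real k * s)"
  have E: "E > 1" "E \<le> 3" using assms exp_le exp_le_cancel_iff[of "real k * s" 1]
    unfolding E_def by (auto simp del: exp_le_cancel_iff)
  have "mean_mult s k * (1 + mean_mult s k) = E / (E - 1)^2"
    using E unfolding mean_mult_def E_def[symmetric] by (simp add: field_simps power2_eq_square)
  moreover have "(E - 1)^2 \<le> 3 * E"
  proof -
    have "(E - 1)^2 = 3 * E - E * (5 - E) + 1" by (simp add: power2_eq_square algebra_simps)
    moreover have "1 * 2 \<le> E * (5 - E)" using E by (intro mult_mono) auto
    ultimately show ?thesis by linarith
  qed
  then have "1/3 \<le> E / (E - 1)^2" using E by (simp add: field_simps)
  ultimately show ?thesis by simp
qed

lemma norm_size_char_le_exp:
  assumes "s > 0" "real K * s \<le> 1" "K \<le> N"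
  shows "cmod (size_char s N t) \<le> exp (- (\<Sum>k=1..K. 1 - cos (real k * t)) / 8)"
proof -
  have "cmod (size_char s N t) \<le> (\<Prod>k=1..N. exp (if k \<le> K then - (1 - cos (real k * t)) / 8 else 0))"
    unfolding size_char_def prod_norm[symmetric]
  proof (intro prod_mono conjI)
    fix k assume k: "k \<in> {1..N}"
    show "cmod (geo_char (mean_mult s k) (real k * t)) \<le> exp (if k \<le> K then - (1 - cos (real k * t)) / 8 else 0)"
    proof (cases "k \<le> K")
      case True
      then have "real k * s \<le> real K * s" using assms by (intro mult_right_mono) auto
      then have "real k * s \<le> 1" using assms by linarith
      then show ?thesis using True k assms(1)
        norm_geo_char_le_exp[OF mean_mult_nonneg mean_mult_variance_ge, of s k "real k * t"]
        by (simp only: if_True atLeastAtMost_iff)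
    qed (simp add: norm_geo_char_le mean_mult_nonneg assms)
  qed auto
  also have "\<dots> = exp (\<Sum>k=1..N. if k \<le> K then - (1 - cos (real k * t)) / 8 else 0)"
    by (simp add: exp_sum)
  also have "(\<Sum>k=1..N. if k \<le> K then - (1 - cos (real k * t)) / 8 else 0)
      = (\<Sum>k=1..K. - (1 - cos (real k * t)) / 8)"
  proof -
    have "{k \<in> {1..N}. k \<le> K} = {1..K}" using assms by auto
    then show ?thesis by (simp add: sum.inter_filter[symmetric])
  qed
  also have "\<dots> = - (\<Sum>k=1..K. 1 - cos (real k * t)) / 8"
    by (simp only: sum_negf sum_divide_distrib[symmetric])
  finally show ?thesis .
qed

text \<open>
  The decay scale of \<open>size_char\<close>.  The variance of the size has order \<open>s^(-3)\<close>, so the characteristic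
  function lives on \<open>t\<close> of order \<open>s^(3/2)\<close>.
\<close>

definition kern :: "real \<Rightarrow> real \<Rightarrow> real" where
  "kern s t = s^3 / (s^3 + t^2)"

lemma kern_bounds: assumes "s > 0" shows "0 < kern s t" "kern s t \<le> 1"
  using assms unfolding kern_def by (auto simp: add_pos_nonneg divide_le_eq_1)

lemma exp_neg_le:
  fixes x :: real assumes "x > 0" "n > 0" shows "exp (- x) \<le> (real n / x) ^ n"
proof -
  have "(x / real n) ^ n \<le> (1 + x / real n) ^ n" using assms by (intro power_mono) auto
  also have "\<dots> \<le> exp x" using assms by (intro exp_ge_one_plus_x_over_n_power_n) auto
  finally have "inverse (exp x) \<le> inverse ((x / real n) ^ n)" using assms by (intro le_imp_inverse_le) auto
  then show ?thesis using assms by (simp add: exp_minus power_divide)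
qed

text \<open>
  Only the parts \<open>k \<le> 1/s\<close>, whose multiplicities have variance at least \<open>1/3\<close>, are used.
\<close>

lemma norm_size_char_le_kern:
  assumes s: "0 < s" "s \<le> 1/2" and N: "real N * s \<ge> 1" and t: "\<bar>t\<bar> \<le> pi"
  shows "cmod (size_char s N t) \<le> (768^12 * 17^4) * kern s t ^ 4"
proof -
  define K where "K = nat \<lfloor>1 / s\<rfloor>"
  have K: "real K \<le> 1 / s" "real K \<ge> 1 / (2 * s)"
  proof -
    have "real K = of_int \<lfloor>1 / s\<rfloor>" unfolding K_def using s by simp
    moreover have "1 / s \<ge> 2" using s by (simp add: field_simps)
    ultimately show "real K \<le> 1 / s" "real K \<ge> 1 / (2 * s)" by linarith+
  qed
  have Ks: "real K * s \<le> 1" using K(1) s by (simp add: field_simps)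
  then have "real K * s \<le> real N * s" using N by linarith
  then have KN: "K \<le> N" using s by simp
  let ?S = "\<Sum>k=1..K. 1 - cos (real k * t)"
  have size_char: "cmod (size_char s N t) \<le> exp (- ?S / 8)" by (rule norm_size_char_le_exp[OF s(1) Ks KN])
  show ?thesis
  proof (cases "real K * \<bar>t\<bar> \<le> 4")
    case True
    let ?u = "t^2 / s^3"
    have u: "1 + ?u > 0" using s by (simp add: add_pos_nonneg)
    have "(1 / (2 * s))^3 \<le> real K ^ 3" using K s by (intro power_mono) auto
    then have "(1 / (2 * s))^3 * (t^2 / 54) \<le> real K ^ 3 * (t^2 / 54)" by (intro mult_right_mono) auto
    then have "?u / 432 \<le> ?S" using sum_one_minus_cos_small[OF True]
      by (simp add: power_divide power_mult_distrib)
    then have 1: "exp (- ?S / 8) \<le> exp (- (?u / 3456))" by simp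
    have "((1 + ?u) / 13824) ^ 4 \<le> (1 + (?u / 3456) / real 4) ^ 4"
      using s by (intro power_mono) (auto simp: field_simps)
    also have "\<dots> \<le> exp (?u / 3456)" using s by (intro exp_ge_one_plus_x_over_n_power_n) (auto intro: order_trans[of _ 0])
    finally have "inverse (exp (?u / 3456)) \<le> inverse (((1 + ?u) / 13824) ^ 4)"
      by (rule le_imp_inverse_le) (use u in simp)
    then have 2: "exp (- (?u / 3456)) \<le> (13824 * inverse (1 + ?u)) ^ 4"
    proof -
      have "inverse ((b / 13824) ^ 4) = (13824 * inverse b) ^ 4" for b :: real
        by (simp add: power_divide power_mult_distrib field_simps)
      then show ?thesis using \<open>inverse (exp (?u / 3456)) \<le> _\<close> by (simp only: exp_minus)
    qed
    have "inverse (1 + ?u) = kern s t"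
      using s u unfolding kern_def by (simp add: field_simps add_pos_nonneg)
    then have "exp (- (?u / 3456)) \<le> 13824^4 * kern s t ^ 4" using 2 by (simp add: power_mult_distrib)
    moreover have "13824^4 * kern s t ^ 4 \<le> (768^12 * 17^4) * kern s t ^ 4"
      using kern_bounds[OF s(1), of t] by (intro mult_right_mono) auto
    ultimately show ?thesis using size_char 1 by linarith
  next
    case False
    then have "?S \<ge> real K / 4" using sum_one_minus_cos_large[OF t, of K] by simp
    moreover have "real K / 4 \<ge> 1 / (8 * s)" using K(2) by (simp add: field_simps)
    ultimately have "?S / 8 \<ge> 1 / (64 * s)" by simp
    then have 1: "exp (- ?S / 8) \<le> exp (- (1 / (64 * s)))" by simp
    have "exp (- (1 / (64 * s))) \<le> (real 12 / (1 / (64 * s))) ^ 12"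
      using s by (intro exp_neg_le) auto
    then have 2: "exp (- (1 / (64 * s))) \<le> 768^12 * (s^3)^4" by (simp add: power_mult_distrib flip: power_mult)
    have "s^3 / 17 \<le> kern s t"
    proof -
      have "t^2 \<le> 4^2" using t pi_less_4 by (intro power2_le_iff_abs_le[THEN iffD2]) auto
      moreover have "s^3 \<le> 1^3" using s by (intro power_mono) auto
      ultimately have "s^3 + t^2 \<le> 17" by simp
      then show ?thesis unfolding kern_def using s by (intro divide_left_mono) (auto intro!: mult_pos_pos add_pos_nonneg)
    qed
    then have "(s^3 / 17)^4 \<le> kern s t ^ 4" using s by (intro power_mono) auto
    then have "768^12 * (s^3)^4 \<le> 768^12 * (17^4 * kern s t ^ 4)"
      by (simp only: power_divide) (simp add: field_simps)
    then show ?thesis using size_char 1 2 by linarith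
  qed
qed

lemma abs_mult_kern_le:
  assumes "s > 0" shows "\<bar>t\<bar> * kern s t \<le> sqrt (s^3)"
proof -
  have "2 * (\<bar>t\<bar> * sqrt (s^3)) \<le> s^3 + t^2"
    using sum_squares_bound[of "\<bar>t\<bar>" "sqrt (s^3)"] assms by (simp add: power2_eq_square)
  moreover have "\<bar>t\<bar> * sqrt (s^3) \<ge> 0" using assms by simp
  ultimately have "\<bar>t\<bar> * sqrt (s^3) \<le> s^3 + t^2" by linarith
  then have "\<bar>t\<bar> * sqrt (s^3) * sqrt (s^3) \<le> (s^3 + t^2) * sqrt (s^3)"
    using assms by (intro mult_right_mono) auto
  then have "\<bar>t\<bar> * s^3 \<le> (s^3 + t^2) * sqrt (s^3)"
    using assms by (simp add: mult.assoc)
  then show ?thesis using assms unfolding kern_def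
    by (simp add: field_simps add_pos_nonneg)
qed

lemma kern_integral:
  assumes "s > 0"
  shows "kern s integrable_on {-pi..pi}" "integral {-pi..pi} (kern s) \<le> pi * sqrt (s^3)"
proof -
  define a where "a = sqrt (s^3)"
  have a: "a > 0" "a^2 = s^3" using assms by (auto simp: a_def)
  have "(kern s has_integral (a * arctan (pi / a) - a * arctan (- pi / a))) {-pi..pi}"
  proof (rule fundamental_theorem_of_calculus)
    fix t :: real
    have "((\<lambda>t. a * arctan (t / a)) has_real_derivative kern s t) (at t within {-pi..pi})"
      unfolding kern_def a(2)[symmetric] using a(1)
      by (auto intro!: derivative_eq_intros simp: field_simps power2_eq_square add_pos_nonneg)
    then show "((\<lambda>t. a * arctan (t / a)) has_vector_derivative kern s t) (at t within {-pi..pi})"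
      by (simp add: has_real_derivative_iff_has_vector_derivative)
  qed auto
  moreover have "a * arctan (pi / a) - a * arctan (- pi / a) \<le> pi * a"
  proof -
    have "a * arctan (pi / a) \<le> a * (pi / 2)" "a * (- arctan (- pi / a)) \<le> a * (pi / 2)"
      using arctan_ubound[of "pi/a"] arctan_lbound[of "-pi/a"] a(1)
      by (intro mult_left_mono; linarith)+
    then show ?thesis by (simp add: algebra_simps)
  qed
  ultimately show "kern s integrable_on {-pi..pi}" "integral {-pi..pi} (kern s) \<le> pi * sqrt (s^3)"
    by (auto simp: integral_unique a_def intro: has_integral_integrable)
qed

section \<open>Gaussian approximation near the origin\<close>

lemma cmod_cis_diff: "cmod (cis t - 1) \<le> \<bar>t\<bar>"
  using iexp_approx1[of t 0] by (simp add: cis_conv_exp)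

lemma cmod_cis_diff2: "cmod (cis t - 1 - \<i> * of_real t) \<le> t^2 / 2"
  using iexp_approx1[of t 1] by (simp add: cis_conv_exp algebra_simps fact_numeral power2_eq_square)

text \<open>
  Third-order comparison with the Gaussian of the same mean and variance, with error explicit in \<open>m\<close>.
  The quotient \<open>h\<close> of the Gaussian and \<open>geo_char\<close> has \<open>h 0 = 1\<close>, and its derivative is
  quadratically small at \<open>0\<close>.
\<close>

lemma geo_char_gauss:
  assumes m: "m \<ge> 0"
  defines "v \<equiv> m * (1 + m)"
  shows "cmod (geo_char m a - exp (\<i> * of_real (m * a) - of_real (v * a^2 / 2))) \<le> v * (1/2 + m) * \<bar>a\<bar>^3"
proof -
  define E where "E = (\<lambda>z::complex. exp (\<i> * (of_real m * z) - of_real v * z^2 / 2))"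
  define h where "h = (\<lambda>z::complex. (1 - of_real m * (exp (\<i> * z) - 1)) * E z)"
  define h' where "h' = (\<lambda>z::complex. E z *
     (- \<i> * of_real v * (exp (\<i> * z) - 1 - \<i> * z) + of_real (m * v) * z * (exp (\<i> * z) - 1)))"
  have v: "v \<ge> 0" using m by (simp add: v_def)
  let ?S = "closed_segment 0 (complex_of_real a)"
  have E: "(E has_field_derivative E z * (\<i> * of_real m - of_real v * z)) (at z within ?S)" for z
    unfolding E_def by (auto intro!: derivative_eq_intros simp: field_simps)
  have "cmod (h (of_real a) - h 0) \<le> (v * (1/2 + m) * \<bar>a\<bar>^2) * cmod (of_real a - 0)"
  proof (rule field_differentiable_bound[where S = ?S])
    fix z assume "z \<in> ?S"
    show "(h has_field_derivative h' z) (at z within ?S)"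
      unfolding h_def by (auto intro!: derivative_eq_intros E simp: h'_def v_def algebra_simps)
    obtain u where u: "0 \<le> u" "u \<le> 1" "z = of_real (u * a)"
      using \<open>z \<in> ?S\<close> by (auto simp: closed_segment_def scaleR_conv_of_real)
    define t where "t = u * a"
    have z: "z = of_real t" using u by (simp add: t_def)
    have t: "\<bar>t\<bar> \<le> \<bar>a\<bar>" using u by (simp add: t_def abs_mult mult_left_le_one_le)
    then have t2: "t^2 \<le> \<bar>a\<bar>^2" by (simp add: abs_le_square_iff)
    have "cmod (E z) = exp (- (v * t^2 / 2))"
      unfolding E_def z norm_exp_eq_Re by (simp add: power2_eq_square)
    then have 1: "cmod (E z) \<le> 1" using v by simp
    have "cmod (- \<i> * of_real v * (exp (\<i> * z) - 1 - \<i> * z) + of_real (m * v) * z * (exp (\<i> * z) - 1))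
        \<le> v * cmod (cis t - 1 - \<i> * of_real t) + m * v * \<bar>t\<bar> * cmod (cis t - 1)"
      unfolding z cis_conv_exp using m v
      by (intro order_trans[OF norm_triangle_ineq]) (simp add: norm_mult)
    also have "\<dots> \<le> v * (t^2 / 2) + m * v * \<bar>t\<bar> * \<bar>t\<bar>"
      using m v by (intro add_mono mult_left_mono cmod_cis_diff cmod_cis_diff2) auto
    also have "\<dots> = v * (1/2 + m) * t^2" by (simp add: power2_eq_square algebra_simps)
    also have "\<dots> \<le> v * (1/2 + m) * \<bar>a\<bar>^2" using m v t2 by (intro mult_left_mono) auto
    finally have 2: "cmod (- \<i> * of_real v * (exp (\<i> * z) - 1 - \<i> * z) + of_real (m * v) * z * (exp (\<i> * z) - 1))
        \<le> v * (1/2 + m) * \<bar>a\<bar>^2" .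
    show "cmod (h' z) \<le> v * (1/2 + m) * \<bar>a\<bar>^2"
      unfolding h'_def norm_mult[of "E z"] using mult_mono[OF 1 2] by simp
  qed auto
  moreover have "h 0 = 1" by (simp add: h_def E_def)
  ultimately have hb: "cmod (h (of_real a) - 1) \<le> v * (1/2 + m) * \<bar>a\<bar>^3"
    by (simp add: power3_eq_cube power2_eq_square mult.assoc)
  have "1 - of_real m * (cis a - 1) \<noteq> 0" using geo_char_denom_ge[OF m, of a] by fastforce
  then have ph: "geo_char m a * h (of_real a) = E (of_real a)"
    by (simp add: geo_char_def h_def cis_conv_exp)
  have "geo_char m a - exp (\<i> * of_real (m * a) - of_real (v * a^2 / 2)) = geo_char m a * (1 - h (of_real a))"
    unfolding right_diff_distrib ph by (simp add: E_def)
  then have "cmod (geo_char m a - exp (\<i> * of_real (m * a) - of_real (v * a^2 / 2)))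
      = cmod (geo_char m a) * cmod (h (of_real a) - 1)"
    by (simp only: norm_mult norm_minus_commute[of 1])
  also have "\<dots> \<le> 1 * cmod (h (of_real a) - 1)" by (intro mult_right_mono norm_geo_char_le m) simp
  finally show ?thesis using hb by simp
qed

lemma exp_neg_bounds:
  assumes "(t::real) > 0"
  shows "exp (-t) < 1" "1 / (1 - exp (-t)) \<le> (1 + t) / t"
proof -
  show l: "exp (-t) < 1" using assms by simp
  have "(1 + t) * exp (-t) \<le> exp t * exp (-t)" using exp_ge_add_one_self[of t] by (intro mult_right_mono) auto
  then have "(1 + t) * exp (-t) \<le> 1" by (simp add: exp_minus)
  then have "t \<le> (1 + t) * (1 - exp (-t))" by (simp add: algebra_simps)
  then show "1 / (1 - exp (-t)) \<le> (1 + t) / t" using l assms by (simp add: field_simps)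
qed

lemma mean_mult_alt:
  assumes "s > 0" "k \<ge> 1"
  defines "t \<equiv> real k * s"
  shows "1 + mean_mult s k = 1 / (1 - exp (- t))" "mean_mult s k = exp (- t) / (1 - exp (- t))"
proof -
  have t: "exp t > 1" using assms by simp
  have "1 + 1 / (E - 1) = 1 / (1 - inverse E)" "1 / (E - 1) = inverse E / (1 - inverse E)" if "E > 1" for E :: real
    using that by (simp_all add: field_simps)
  from this[OF t] show "1 + mean_mult s k = 1 / (1 - exp (- t))" "mean_mult s k = exp (- t) / (1 - exp (- t))"
    by (simp_all add: mean_mult_def exp_minus t_def)
qed

lemma mean_mult_moments:
  assumes s: "s > 0" and k: "k \<ge> 1"
  defines "t \<equiv> real k * s" and "m \<equiv> mean_mult s k"
  shows "real k^2 * (m * (1 + m)) \<le> 16 / s^2 * exp (- real k * (s/2))"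
    and "real k^3 * (m * (1 + m) * (1/2 + m)) \<le> 216 / s^3 * exp (- real k * (s/2))"
proof -
  have t: "t > 0" using assms by simp
  have m: "m > 0" using s k unfolding m_def by (rule mean_mult_pos)
  have e: "exp (-t) > 0" by simp
  have 1: "1 + m \<le> (1 + t) / t"
    using mean_mult_alt(1)[OF s k] exp_neg_bounds(2)[OF t] by (simp add: m_def t_def)
  have "m = exp (-t) * (1 + m)"
    using mean_mult_alt[OF s k] by (simp add: m_def t_def)
  also have "\<dots> \<le> exp (-t) * ((1 + t) / t)" using 1 by (intro mult_left_mono) auto
  finally have 2: "m \<le> exp (-t) * ((1 + t) / t)" .
  have exp2: "exp (-t) = exp (- (t/2)) * exp (- (t/2))" by (simp add: exp_add[symmetric])
  have ks: "real k = t / s" using s by (simp add: t_def)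
  have ek: "exp (- real k * (s/2)) = exp (- (t/2))" by (simp add: t_def)
  have "(1 + t)^2 \<le> 16 * exp (t/2)"
  proof -
    have "(1 + t)^2 \<le> (4 * exp (t/4))^2"
    proof (intro power_mono)
      show "1 + t \<le> 4 * exp (t/4)" using exp_ge_add_one_self[of "t/4"] t by linarith
    qed (use t in simp)
    also have "\<dots> = 16 * exp (t/2)" by (simp add: power_mult_distrib flip: exp_of_nat_mult)
    finally show ?thesis .
  qed
  then have "exp (-t) * (1 + t)^2 \<le> exp (-t) * (16 * exp (t/2))" by (intro mult_left_mono) auto
  then have b2: "exp (-t) * (1 + t)^2 \<le> 16 * exp (- (t/2))"
    unfolding exp2 by (simp add: exp_minus field_simps)
  have "(1 + t)^3 \<le> 216 * exp (t/2)"
  proof -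
    have "(1 + t)^3 \<le> (6 * exp (t/6))^3"
    proof (intro power_mono)
      show "1 + t \<le> 6 * exp (t/6)" using exp_ge_add_one_self[of "t/6"] t by linarith
    qed (use t in simp)
    also have "\<dots> = 216 * exp (t/2)" by (simp add: power_mult_distrib flip: exp_of_nat_mult)
    finally show ?thesis .
  qed
  then have "exp (-t) * (1 + t)^3 \<le> exp (-t) * (216 * exp (t/2))" by (intro mult_left_mono) auto
  then have b3: "exp (-t) * (1 + t)^3 \<le> 216 * exp (- (t/2))"
    unfolding exp2 by (simp add: exp_minus field_simps)
  have "m * (1 + m) \<le> exp (-t) * ((1 + t) / t) * ((1 + t) / t)"
    using 1 2 m t by (intro mult_mono) auto
  also have "\<dots> = exp (-t) * (1 + t)^2 / t^2" by (simp add: power2_eq_square)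
  finally have v: "m * (1 + m) \<le> exp (-t) * (1 + t)^2 / t^2" .
  then have "real k^2 * (m * (1 + m)) \<le> (t/s)^2 * (exp (-t) * (1 + t)^2 / t^2)"
    unfolding ks by (intro mult_left_mono) auto
  also have "\<dots> = exp (-t) * (1 + t)^2 / s^2" using t by (simp add: power_divide)
  also have "\<dots> \<le> 16 * exp (- (t/2)) / s^2" using b2 by (intro divide_right_mono) auto
  finally show "real k^2 * (m * (1 + m)) \<le> 16 / s^2 * exp (- real k * (s/2))"
    unfolding ek by simp
  have "m * (1 + m) * (1/2 + m) \<le> exp (-t) * (1 + t)^2 / t^2 * ((1 + t) / t)"
    using v 1 m t by (intro mult_mono) auto
  also have "\<dots> = exp (-t) * (1 + t)^3 / t^3" by (simp add: power2_eq_square power3_eq_cube)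
  finally have "real k^3 * (m * (1 + m) * (1/2 + m)) \<le> (t/s)^3 * (exp (-t) * (1 + t)^3 / t^3)"
    unfolding ks by (intro mult_left_mono) (use t s in auto)
  also have "\<dots> = exp (-t) * (1 + t)^3 / s^3" using t by (simp add: power_divide)
  also have "\<dots> \<le> 216 * exp (- (t/2)) / s^3" using b3 s by (intro divide_right_mono) auto
  finally show "real k^3 * (m * (1 + m) * (1/2 + m)) \<le> 216 / s^3 * exp (- real k * (s/2))"
    unfolding ek by simp
qed

lemma sum_exp_le:
  assumes "u > 0" shows "(\<Sum>k=1..n. exp (- real k * u)) \<le> 1 / u"
proof -
  have "(\<Sum>k=1..n. exp (- real k * u)) \<le> (1 - exp (- real n * u)) / u"
  proof (induction n)
    case (Suc n)
    let ?e = "exp (- real (Suc n) * u)"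
    have e: "exp (- real n * u) = ?e * exp u" by (simp add: exp_add[symmetric] algebra_simps)
    have "?e * (1 + u) \<le> ?e * exp u" using exp_ge_add_one_self[of u] by (intro mult_left_mono) auto
    then have "?e \<le> (?e * exp u - ?e) / u" using assms by (simp add: field_simps)
    then show ?case using Suc unfolding e
      by (simp add: diff_divide_distrib del: of_nat_Suc)
  qed simp
  also have "\<dots> \<le> 1 / u" using assms by (intro divide_right_mono) auto
  finally show ?thesis .
qed

text \<open>
  Mean of the size whose characteristic function is \<open>size_char\<close>.
\<close>

definition size_mean :: "real \<Rightarrow> nat \<Rightarrow> real" where
  "size_mean s N = (\<Sum>k=1..N. real k * mean_mult s k)"

text \<open>
  Variance of the size whose characteristic function is \<open>size_char\<close>.
\<close>

definition size_var :: "real \<Rightarrow> nat \<Rightarrow> real" where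
  "size_var s N = (\<Sum>k=1..N. real k^2 * (mean_mult s k * (1 + mean_mult s k)))"

lemma size_var_bounds:
  assumes "s > 0" shows "0 \<le> size_var s N" "size_var s N \<le> 32 / s^3"
proof -
  show "0 \<le> size_var s N" unfolding size_var_def
    using mean_mult_nonneg[OF assms] by (intro sum_nonneg) auto
  have "size_var s N \<le> (\<Sum>k=1..N. 16 / s^2 * exp (- real k * (s/2)))"
    unfolding size_var_def using assms by (intro sum_mono mean_mult_moments) auto
  also have "\<dots> = 16 / s^2 * (\<Sum>k=1..N. exp (- real k * (s/2)))" by (simp only: sum_distrib_left)
  also have "\<dots> \<le> 16 / s^2 * (1 / (s/2))" using assms by (intro mult_left_mono sum_exp_le) auto
  finally show "size_var s N \<le> 32 / s^3" by (simp add: power2_eq_square power3_eq_cube)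
qed

lemma size_char_gauss:
  assumes "s > 0"
  shows "cmod (size_char s N t - exp (\<i> * of_real (size_mean s N * t) - of_real (size_var s N * t^2 / 2)))
         \<le> 432 / s^4 * \<bar>t\<bar>^3"
proof -
  let ?m = "mean_mult s"
  let ?e = "\<lambda>k. exp (\<i> * of_real (?m k * (real k * t)) - of_real (?m k * (1 + ?m k) * (real k * t)^2 / 2))"
  have "exp (\<i> * of_real (size_mean s N * t) - of_real (size_var s N * t^2 / 2)) = (\<Prod>k=1..N. ?e k)"
    unfolding exp_sum[symmetric, OF finite_atLeastAtMost] size_mean_def size_var_def sum_subtractf
    by (simp add: sum_distrib_left sum_distrib_right sum_divide_distrib power_mult_distrib algebra_simps
             del: exp_sum)
  then have "cmod (size_char s N t - exp (\<i> * of_real (size_mean s N * t) - of_real (size_var s N * t^2 / 2)))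
       \<le> (\<Sum>k=1..N. cmod (geo_char (?m k) (real k * t) - ?e k))"
  proof (simp only: size_char_def, intro norm_prod_diff)
    fix k
    show "cmod (geo_char (?m k) (real k * t)) \<le> 1" by (intro norm_geo_char_le mean_mult_nonneg assms)
    show "cmod (?e k) \<le> 1" unfolding norm_exp_eq_Re
      using mean_mult_nonneg[OF assms, of k] by simp
  qed
  also have "\<dots> \<le> (\<Sum>k=1..N. 216 / s^3 * exp (- real k * (s/2)) * \<bar>t\<bar>^3)"
  proof (rule sum_mono)
    fix k assume k: "k \<in> {1..N}"
    have "cmod (geo_char (?m k) (real k * t) - ?e k) \<le> ?m k * (1 + ?m k) * (1/2 + ?m k) * \<bar>real k * t\<bar>^3"
      by (intro geo_char_gauss mean_mult_nonneg assms)
    also have "\<dots> = real k^3 * (?m k * (1 + ?m k) * (1/2 + ?m k)) * \<bar>t\<bar>^3"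
      by (simp add: abs_mult power_mult_distrib)
    also have "\<dots> \<le> 216 / s^3 * exp (- real k * (s/2)) * \<bar>t\<bar>^3"
      using k assms by (intro mult_right_mono mean_mult_moments) auto
    finally show "cmod (geo_char (?m k) (real k * t) - ?e k) \<le> 216 / s^3 * exp (- real k * (s/2)) * \<bar>t\<bar>^3" .
  qed
  also have "\<dots> = 216 / s^3 * (\<Sum>k=1..N. exp (- real k * (s/2))) * \<bar>t\<bar>^3"
    by (simp only: sum_distrib_left sum_distrib_right)
  also have "\<dots> \<le> 216 / s^3 * (1 / (s/2)) * \<bar>t\<bar>^3"
    using assms by (intro mult_right_mono mult_left_mono sum_exp_le) auto
  also have "\<dots> = 432 / s^4 * \<bar>t\<bar>^3" by (simp add: eval_nat_numeral)
  finally show ?thesis .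
qed

lemma exp_neg_kernel_upper:
  fixes t :: real assumes "t > 0" shows "exp (-t) / (1 - exp (-t))^2 \<le> 1 / t^2"
proof -
  let ?f = "\<lambda>x::real. exp (x/2) - exp (- x/2) - x"
  have "?f 0 \<le> ?f t"
  proof (rule DERIV_nonneg_imp_nondecreasing[where f = ?f])
    fix x :: real
    have "DERIV ?f x :> cosh (x/2) - 1"
      by (auto intro!: derivative_eq_intros simp: cosh_def)
    then show "\<exists>y. DERIV ?f x :> y \<and> y \<ge> 0" using cosh_real_ge_1[of "x/2"] by fastforce
  qed (use assms in simp)
  then have "t \<le> exp (t/2) - exp (- t/2)" by simp
  then have "t * exp (-t/2) \<le> (exp (t/2) - exp (- t/2)) * exp (-t/2)" by (intro mult_right_mono) auto
  also have "\<dots> = 1 - exp (-t)" by (simp add: left_diff_distrib exp_add[symmetric])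
  finally have "(t * exp (-t/2))^2 \<le> (1 - exp (-t))^2" using assms by (intro power_mono) auto
  then have "t^2 * exp (-t) \<le> (1 - exp (-t))^2" by (simp add: power_mult_distrib flip: exp_of_nat_mult)
  moreover have "(1 - exp (-t))^2 > 0" using assms by simp
  ultimately show ?thesis using assms by (simp add: field_simps)
qed

text \<open>
  After multiplication by \<open>t^2 (1 - y)^2\<close>, where \<open>y = exp (-t)\<close>, this is
  \<open>(1 - y)^2 \<le> t^2 (1 + y)^2 / 4\<close>, because \<open>y + (1 - y)^2 / 4 = (1 + y)^2 / 4\<close>.
\<close>

lemma exp_neg_kernel_lower:
  fixes t :: real assumes "t > 0" shows "1 / t^2 - 1/4 \<le> exp (-t) / (1 - exp (-t))^2"
proof -
  let ?f = "\<lambda>x::real. x * (1 + exp (-x)) / 2 + exp (-x) - 1"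
  define y where "y = exp (-t)"
  have y: "0 < y" "y < 1" using assms by (auto simp: y_def)
  have "?f 0 \<le> ?f t"
  proof (rule DERIV_nonneg_imp_nondecreasing[where f = ?f])
    fix x :: real
    have "(1 + x) * exp (-x) \<le> exp x * exp (-x)" using exp_ge_add_one_self[of x] by (intro mult_right_mono) auto
    then have "(1 + x) * exp (-x) \<le> 1" by (simp add: exp_minus)
    moreover have "DERIV ?f x :> (1 - (1 + x) * exp (-x)) / 2"
      by (auto intro!: derivative_eq_intros simp: field_simps)
    ultimately show "\<exists>y. DERIV ?f x :> y \<and> y \<ge> 0" by fastforce
  qed (use assms in simp)
  then have "1 - y \<le> t * (1 + y) / 2" by (simp add: y_def)
  then have "(1 - y)^2 \<le> (t * (1 + y) / 2)^2" using y by (intro power_mono) auto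
  also have "\<dots> = t^2 * (y + (1 - y)^2 / 4)"
    by (simp add: power2_eq_square field_simps)
  finally have "(1 - y)^2 / (t^2 * (1 - y)^2) \<le> t^2 * (y + (1 - y)^2 / 4) / (t^2 * (1 - y)^2)"
    by (intro divide_right_mono) auto
  then have "1 / t^2 \<le> (y + (1 - y)^2 / 4) / (1 - y)^2" using y assms by simp
  also have "\<dots> = y / (1 - y)^2 + 1/4" using y by (simp add: add_divide_distrib)
  finally show ?thesis by (simp add: y_def)
qed

lemma kernel_defect:
  fixes t :: real assumes "t > 0"
  shows "1 / t^2 - exp (-t) / (1 - exp (-t))^2 \<le> 4 / (1 + t)^2"
proof (cases "t \<le> 1")
  case True
  have "(1 + t)^2 \<le> 2^2" using assms True by (intro power_mono) auto
  then have "1 \<le> 4 / (1 + t)^2" using assms by (simp add: field_simps)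
  then show ?thesis using exp_neg_kernel_lower[OF assms] by linarith
next
  case False
  have "(1 + t)^2 \<le> (2 * t)^2" using False by (intro power_mono) auto
  then have "1 / t^2 \<le> 4 / (1 + t)^2" using assms by (simp add: field_simps power_mult_distrib)
  moreover have "exp (-t) / (1 - exp (-t))^2 \<ge> 0" by simp
  ultimately show ?thesis by linarith
qed

lemma sum_inverse_square_le:
  assumes "s > 0" shows "(\<Sum>b<B. 4 / (1 + real (Suc b) * s)^2) \<le> 4 / s"
proof -
  have "(\<Sum>b<B. 4 / (1 + real (Suc b) * s)^2) \<le> (4 / s) * (1 - 1 / (1 + real B * s))"
  proof (induction B)
    case (Suc B)
    define u where "u = 1 + real B * s"
    have u: "u > 0" using assms by (simp add: u_def add_pos_nonneg)
    have "4 / (u + s)^2 \<le> 4 / (u * (u + s))"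
      using u assms by (intro divide_left_mono) (auto simp: power2_eq_square intro!: mult_pos_pos mult_right_mono)
    also have "\<dots> = (4 / s) * (1 / u - 1 / (u + s))" using u assms by (simp add: field_simps)
    finally have "4 / (1 + real (Suc B) * s)^2 \<le> (4 / s) * (1 / (1 + real B * s) - 1 / (1 + real (Suc B) * s))"
      by (simp add: u_def algebra_simps)
    then show ?case using Suc by (simp add: right_diff_distrib del: of_nat_Suc)
  qed simp
  also have "\<dots> \<le> (4 / s) * 1" using assms by (intro mult_left_mono) (auto simp: add_nonneg_nonneg)
  finally show ?thesis by simp
qed

lemma geometric_weighted:
  fixes y :: real
  shows "(1 - y)^2 * (\<Sum>k=1..n. real k * y^k) = y - (real n + 1) * y^(n+1) + real n * y^(n+2)"
proof (induction n)
  case (Suc n)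
  have "(1 - y)^2 * (\<Sum>k=1..Suc n. real k * y^k)
      = (y - (real n + 1) * y^(n+1) + real n * y^(n+2)) + (1 - y)^2 * ((real n + 1) * y^(n+1))"
    using Suc by (simp add: distrib_left)
  then show ?case by (simp add: power2_eq_square algebra_simps)
qed (simp add: power2_eq_square)

lemma geometric_weighted_bounds:
  fixes t :: real assumes "t > 0"
  defines "y \<equiv> exp (-t)"
  shows "(\<Sum>k=1..n. real k * y^k) \<le> y / (1 - y)^2"
    and "(\<Sum>k=1..n. real k * y^k) \<ge> (1 - (real n + 1) * y^n) * (y / (1 - y)^2)"
proof -
  let ?S = "\<Sum>k=1..n. real k * y^k"
  have y: "0 < y" "y < 1" using assms by auto
  have eq: "?S = (y - (real n + 1) * y^(n+1) + real n * y^(n+2)) / (1 - y)^2"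
    using geometric_weighted[of y n] y by (simp add: field_simps)
  have "real n * y^(n+2) \<le> (real n + 1) * y^(n+1)"
    using y by (intro mult_mono power_decreasing) auto
  then show "?S \<le> y / (1 - y)^2" unfolding eq by (intro divide_right_mono) auto
  have "(1 - (real n + 1) * y^n) * y \<le> y - (real n + 1) * y^(n+1) + real n * y^(n+2)"
    using y by (simp add: algebra_simps)
  then have "(1 - (real n + 1) * y^n) * y / (1 - y)^2 \<le> ?S" unfolding eq by (intro divide_right_mono) auto
  then show "?S \<ge> (1 - (real n + 1) * y^n) * (y / (1 - y)^2)" by simp
qed

text \<open>
  Expanding the geometric series turns the mean into \<open>(\<Sum>b\<ge>1. \<Sum>k=1..N. k y^k)\<close> with
  \<open>y = exp (- b s)\<close>, to be compared with \<open>(\<Sum>b\<ge>1. 1 / (b s)^2) = \<pi>^2 / (6 s^2)\<close>.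
\<close>

lemma size_mean_sums:
  assumes "s > 0"
  shows "(\<lambda>b. \<Sum>k=1..N. real k * exp (- (real (Suc b) * s)) ^ k) sums size_mean s N"
  unfolding size_mean_def
proof (intro sums_sum)
  fix k assume k: "k \<in> {1..N}"
  let ?y = "exp (- (real k * s))"
  have "(\<lambda>b. ?y ^ Suc b) sums (?y / (1 - ?y))"
    using geometric_sums[of ?y] sums_mult[of "\<lambda>b. ?y ^ b" "1 / (1 - ?y)" ?y] k assms by simp
  moreover have "?y / (1 - ?y) = mean_mult s k"
    using mean_mult_alt(2)[OF assms, of k] k by simp
  moreover have "?y ^ Suc b = exp (- (real (Suc b) * s)) ^ k" for b
    by (simp add: exp_of_nat_mult[symmetric] algebra_simps del: power_Suc)
  ultimately show "(\<lambda>b. real k * exp (- (real (Suc b) * s)) ^ k) sums (real k * mean_mult s k)"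
    by (intro sums_mult) simp
qed

lemma size_mean_approx:
  assumes s: "0 < s" "s \<le> 1/2" and n: "real n * s^2 = pi^2 / 6"
  shows "\<bar>size_mean s n - real n\<bar> \<le> 260 / s"
proof -
  let ?I = "\<lambda>b. \<Sum>k=1..n. real k * exp (- (real (Suc b) * s)) ^ k"
  let ?q = "\<lambda>b. 1 / (real (Suc b) * s)^2"
  have n': "real n = (pi^2/6) / s^2" using n s by (simp add: field_simps)
  have "1 / real ((b + 1)^2) / s^2 = ?q b" for b
    by (simp add: power_mult_distrib)
  then have q: "?q sums real n"
    using sums_divide[OF inverse_squares_sums, of "s^2"] unfolding n' by (simp only:)
  have I: "?I sums size_mean s n" by (rule size_mean_sums[OF s(1)])
  define d where "d = (real n + 1) * exp (- (real n * s))"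
  have b: "?I b \<le> ?q b" "?q b - ?I b \<le> 4 / (1 + real (Suc b) * s)^2 + d * ?q b" for b
  proof -
    let ?t = "real (Suc b) * s"
    have t: "?t > 0" using s by simp
    note K = exp_neg_kernel_upper[OF t]
    show "?I b \<le> ?q b" using geometric_weighted_bounds(1)[OF t, of n] K by linarith
    let ?k = "exp (- ?t) / (1 - exp (- ?t))^2"
    have "exp (- ?t) ^ n \<le> exp (- (real n * s))"
      using s by (simp add: exp_of_nat_mult[symmetric] algebra_simps)
    then have "(real n + 1) * exp (- ?t)^n \<le> d" unfolding d_def by (intro mult_left_mono) auto
    then have "(1 - d) * ?k \<le> (1 - (real n + 1) * exp (- ?t)^n) * ?k" by (intro mult_right_mono) auto
    also have "\<dots> \<le> ?I b" by (rule geometric_weighted_bounds(2)[OF t])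
    finally have "?k - d * ?k \<le> ?I b" by (simp only: left_diff_distrib mult_1_left)
    moreover have "d * ?k \<le> d * ?q b" using K unfolding d_def by (intro mult_left_mono) auto
    ultimately show "?q b - ?I b \<le> 4 / (1 + real (Suc b) * s)^2 + d * ?q b"
      using kernel_defect[OF t] by linarith
  qed
  have up: "size_mean s n \<le> real n" using sums_le[OF _ I q] b(1) by blast
  have "real n - size_mean s n \<le> 4 / s + d * real n"
  proof (rule LIMSEQ_le_const2)
    show "(\<lambda>B. \<Sum>b<B. ?q b - ?I b) \<longlonglongrightarrow> real n - size_mean s n"
      using sums_diff[OF q I] unfolding sums_def .
    have "(\<Sum>b<B. ?q b - ?I b) \<le> 4 / s + d * real n" for B
    proof -
      have "(\<Sum>b<B. ?q b - ?I b) \<le> (\<Sum>b<B. 4 / (1 + real (Suc b) * s)^2 + d * ?q b)"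
        by (intro sum_mono b)
      also have "\<dots> = (\<Sum>b<B. 4 / (1 + real (Suc b) * s)^2) + d * (\<Sum>b<B. ?q b)"
        by (simp only: sum.distrib sum_distrib_left)
      also have "(\<Sum>b<B. ?q b) \<le> real n" 
        using sum_le_suminf[of ?q "{..<B}"] q by (simp add: sums_iff)
      finally show ?thesis using sum_inverse_square_le[OF s(1), of B]
        by (smt (verit) d_def mult_left_mono exp_ge_zero mult_nonneg_nonneg of_nat_0_le_iff)
    qed
    then show "\<exists>N. \<forall>B\<ge>N. (\<Sum>b<B. ?q b - ?I b) \<le> 4 / s + d * real n" by blast
  qed
  moreover have "d * real n \<le> 256 / s"
  proof -
    define x where "x = real n * s"
    have pi2: "pi^2 / 6 \<ge> 1" using power_mono[of 3 pi 2] pi_gt3 by simp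
    have x: "x = (pi^2/6) / s" using n s by (simp add: x_def field_simps power2_eq_square)
    have "1 / s \<le> x" unfolding x using pi2 s by (intro divide_right_mono) auto
    moreover have "1 / s > 0" using s by simp
    ultimately have x0: "x > 0" by linarith
    have "exp (- x) \<le> (real 4 / x)^4" by (rule exp_neg_le[OF x0]) simp
    then have e: "exp (- x) \<le> 256 / x^4" by (simp add: power_divide)
    have n1: "real n \<ge> 1" using x0 s unfolding x_def by (cases n) auto
    have "d * real n \<le> (2 * real n) * exp (- x) * real n"
      unfolding d_def x_def using n1 by (intro mult_right_mono) auto
    also have "\<dots> \<le> (2 * real n) * (256 / x^4) * real n" using e by (intro mult_right_mono mult_left_mono) auto
    also have "\<dots> = 512 * (real n^2 / x^4)" by (simp add: power2_eq_square)
    also have "real n^2 / x^4 = 1 / (real n * s^2)^2"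
      using n1 s by (simp add: x_def field_simps power_mult_distrib eval_nat_numeral)
    also have "\<dots> \<le> 1" unfolding n using pi2 by (simp add: divide_le_eq_1 one_le_power)
    also have "512 * 1 \<le> 256 / s" using s by (simp add: field_simps)
    finally show ?thesis by simp
  qed
  ultimately have "real n - size_mean s n \<le> 260 / s" by (simp add: add_divide_distrib[symmetric])
  then show ?thesis using up by simp
qed

section \<open>Local estimates for partition numbers\<close>

text \<open>
  The constant of \<open>norm_size_char_le_kern\<close>.
\<close>

definition decay_const :: real where "decay_const = 768^12 * 17^4"

lemma decay_const_ge_1: "decay_const \<ge> 1" by (simp add: decay_const_def)

lemma norm_size_char_le_decay:
  assumes "0 < s" "s \<le> 1/2" "real N * s \<ge> 1" "\<bar>t\<bar> \<le> pi"
  shows "cmod (size_char s N t) \<le> decay_const * kern s t ^ 4"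
  using norm_size_char_le_kern[OF assms] by (simp only: decay_const_def)

text \<open>
  Three of the four powers of \<open>kern\<close> in the decay of \<open>size_char\<close> can be spent on the weight \<open>g\<close>; the
  fourth makes the integral of order \<open>s^(3/2)\<close>.
\<close>

lemma norm_integral_size_char_le:
  assumes s: "0 < s" "s \<le> 1/2" and N: "real N * s \<ge> 1"
    and g: "continuous_on {-pi..pi} g" and B: "\<And>t. \<bar>t\<bar> \<le> pi \<Longrightarrow> kern s t ^ 3 * cmod (g t) \<le> B"
  shows "cmod (integral {-pi..pi} (\<lambda>t. size_char s N t * g t)) \<le> decay_const * B * (pi * sqrt (s^3))"
proof -
  have B0: "B \<ge> 0" using B[of 0] kern_bounds[OF s(1), of 0] 
    by (smt (verit) mult_nonneg_nonneg norm_ge_zero pi_ge_zero zero_le_power abs_zero)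
  have "cmod (integral {-pi..pi} (\<lambda>t. size_char s N t * g t)) \<le> integral {-pi..pi} (\<lambda>t. decay_const * B * kern s t)"
  proof (rule integral_norm_bound_integral)
    show "(\<lambda>t. size_char s N t * g t) integrable_on {-pi..pi}"
      using s g by (intro integrable_continuous_interval continuous_intros) auto
    show "(\<lambda>t. decay_const * B * kern s t) integrable_on {-pi..pi}"
      using integrable_cmul[OF kern_integral(1)[OF s(1)], of "decay_const * B"] by simp
    fix t assume "t \<in> {-pi..pi}"
    then have t: "\<bar>t\<bar> \<le> pi" by auto
    have "cmod (size_char s N t * g t) \<le> decay_const * kern s t ^ 4 * cmod (g t)"
      unfolding norm_mult by (intro mult_right_mono norm_size_char_le_decay s N t) auto
    also have "\<dots> = decay_const * kern s t * (kern s t ^ 3 * cmod (g t))"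
      by (simp add: eval_nat_numeral)
    also have "\<dots> \<le> decay_const * kern s t * B"
      using B[OF t] kern_bounds[OF s(1), of t] decay_const_ge_1 by (intro mult_left_mono) auto
    finally show "cmod (size_char s N t * g t) \<le> decay_const * B * kern s t" by (simp add: mult_ac)
  qed
  also have "\<dots> = decay_const * B * integral {-pi..pi} (kern s)" by simp
  also have "\<dots> \<le> decay_const * B * (pi * sqrt (s^3))"
    using B0 decay_const_ge_1 by (intro mult_left_mono kern_integral s) auto
  finally show ?thesis .
qed

lemma sqrt_cube: "s \<ge> 0 \<Longrightarrow> sqrt (s^3) = s * sqrt s"
  by (simp add: power3_eq_cube real_sqrt_mult)

lemma sqrt_cube_le: assumes "0 \<le> s" "s \<le> 1" shows "sqrt (s^3) \<le> s"
  using assms mult_left_mono[of "sqrt s" 1 s] by (simp add: sqrt_cube)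

lemma one_minus_exp_bounds: assumes "(s::real) \<ge> 0" shows "0 \<le> 1 - exp (-s)" "1 - exp (-s) \<le> s"
  using exp_ge_add_one_self[of "-s"] assms by auto

lemma norm_gap_factor_le:
  assumes s: "0 < s" and j: "j \<le> 4"
  shows "cmod (gap_factor s j t) \<le> (3 * (s + \<bar>t\<bar>)) ^ (j - 1)"
proof -
  have "cmod (gap_factor s j t) \<le> (\<Prod>i=1..<j. 3 * (s + \<bar>t\<bar>))"
    unfolding gap_factor_def prod_norm[symmetric]
  proof (intro prod_mono conjI)
    fix i assume i: "i \<in> {1..<j}"
    let ?y = "exp (- real i * s)"
    have "1 - of_real ?y * cis (real i * t) = of_real (1 - ?y) - of_real ?y * (cis (real i * t) - 1)"
      by (simp add: algebra_simps)
    then have "cmod (1 - of_real ?y * cis (real i * t)) \<le> cmod (of_real (1 - ?y)) + cmod (of_real ?y * (cis (real i * t) - 1))"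
      by (simp only: norm_triangle_ineq4)
    also have "cmod (of_real (1 - ?y)) = 1 - ?y"
      using one_minus_exp_bounds(1)[of "real i * s"] s by (simp del: of_real_diff)
    also have "\<dots> \<le> real i * s" using one_minus_exp_bounds(2)[of "real i * s"] s by simp
    also have "cmod (of_real ?y * (cis (real i * t) - 1)) \<le> 1 * \<bar>real i * t\<bar>"
      unfolding norm_mult using s by (intro mult_mono cmod_cis_diff) auto
    also have "real i * s + 1 * \<bar>real i * t\<bar> = real i * (s + \<bar>t\<bar>)" by (simp add: abs_mult algebra_simps)
    also have "\<dots> \<le> 3 * (s + \<bar>t\<bar>)" using i j s by (intro mult_right_mono) auto
    finally show "cmod (1 - of_real ?y * cis (real i * t)) \<le> 3 * (s + \<bar>t\<bar>)" by simp
  qed auto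
  then show ?thesis by simp
qed

lemma kern_gap_factor_le:
  assumes s: "0 < s" "s \<le> 1/2" and j: "1 \<le> j" "j \<le> 4"
  shows "kern s t ^ 3 * cmod (cis x * gap_factor s j t) \<le> 216 * s ^ (j - 1)"
proof -
  note k = kern_bounds[OF s(1), of t]
  have "kern s t * (s + \<bar>t\<bar>) \<le> 2 * s"
  proof -
    have "kern s t * s \<le> 1 * s" using k s by (intro mult_right_mono) auto
    moreover have "\<bar>t\<bar> * kern s t \<le> s"
      using abs_mult_kern_le[OF s(1), of t] sqrt_cube_le[of s] s by linarith
    ultimately show ?thesis by (simp add: distrib_left mult.commute)
  qed
  moreover have "kern s t * (3 * (s + \<bar>t\<bar>)) = 3 * (kern s t * (s + \<bar>t\<bar>))" by (simp only: mult.left_commute)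
  ultimately have "kern s t * (3 * (s + \<bar>t\<bar>)) \<le> 6 * s" by linarith
  moreover have "kern s t * (3 * (s + \<bar>t\<bar>)) \<ge> 0" using k s by (intro mult_nonneg_nonneg) auto
  ultimately have le: "(kern s t * (3 * (s + \<bar>t\<bar>))) ^ (j - 1) \<le> (6 * s) ^ (j - 1)"
    by (rule power_mono)
  have "kern s t ^ 3 * cmod (cis x * gap_factor s j t) \<le> kern s t ^ (j - 1) * (3 * (s + \<bar>t\<bar>)) ^ (j - 1)"
    using k j s norm_gap_factor_le[OF s(1) j(2), of t]
    by (intro mult_mono power_decreasing) (auto simp: norm_mult)
  also have "\<dots> \<le> (6 * s) ^ (j - 1)" using le by (simp only: power_mult_distrib)
  also have "\<dots> = 6 ^ (j - 1) * s ^ (j - 1)" by (simp add: power_mult_distrib)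
  also have "\<dots> \<le> 6 ^ 3 * s ^ (j - 1)"
    using j s by (intro mult_right_mono power_increasing) auto
  finally show ?thesis by simp
qed

text \<open>
  This weight arises from \<open>wsum 2\<close> at \<open>n - k\<close> minus the expected multiple of \<open>wsum 1\<close> at \<open>n\<close>; it
  vanishes at \<open>t = 0\<close>.
\<close>

lemma kern_two_term_le:
  assumes s: "0 < s" "s \<le> 1/2"
  shows "kern s t ^ 3 * cmod (cis x * (cis (real k * t) * gap_factor s 2 t - of_real (1 - exp (- s))))
         \<le> (1 + s * real k) * sqrt (s^3)"
proof -
  note kb = kern_bounds[OF s(1), of t]
  let ?y = "exp (-s)"
  have "cis (real k * t) * gap_factor s 2 t - of_real (1 - ?y)
      = (cis (real k * t) - 1) * of_real (1 - ?y) - of_real ?y * cis (real k * t) * (cis t - 1)"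
    by (simp add: gap_factor_def numeral_2_eq_2 algebra_simps)
  then have "cmod (cis x * (cis (real k * t) * gap_factor s 2 t - of_real (1 - ?y)))
     \<le> cmod ((cis (real k * t) - 1) * of_real (1 - ?y)) + cmod (of_real ?y * cis (real k * t) * (cis t - 1))"
    by (simp only: norm_mult[of "cis x"] norm_cis mult_1_left norm_triangle_ineq4)
  also have "\<dots> \<le> \<bar>real k * t\<bar> * s + 1 * 1 * \<bar>t\<bar>"
    unfolding norm_mult using one_minus_exp_bounds[of s] s
    by (intro add_mono mult_mono cmod_cis_diff) (auto simp del: of_real_diff)
  also have "\<dots> = (1 + s * real k) * \<bar>t\<bar>" by (simp add: abs_mult algebra_simps)
  finally have "kern s t ^ 3 * cmod (cis x * (cis (real k * t) * gap_factor s 2 t - of_real (1 - ?y)))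
     \<le> kern s t ^ 1 * ((1 + s * real k) * \<bar>t\<bar>)"
    using kb s by (intro mult_mono power_decreasing) auto
  also have "\<dots> = (1 + s * real k) * (\<bar>t\<bar> * kern s t)" by simp
  also have "\<dots> \<le> (1 + s * real k) * sqrt (s^3)"
    using s by (intro mult_left_mono abs_mult_kern_le) auto
  finally show ?thesis .
qed

lemma scale_bounds:
  assumes "0 < s" "s \<le> 1/2" "real n * s^2 = pi^2 / 6"
  shows "real n * s \<ge> 1" "real n \<ge> 1"
proof -
  have pi2: "pi^2 / 6 \<ge> 1" using power_mono[of 3 pi 2] pi_gt3 by simp
  have "(real n * s) * s = pi^2 / 6" using assms(3) by (simp add: power2_eq_square mult.assoc)
  then have "1 * s \<le> (real n * s) * s" using pi2 assms by linarith
  then show 1: "real n * s \<ge> 1" using assms(1) by (rule mult_right_le_imp_le)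
  show "real n \<ge> 1" using 1 assms by (cases n) auto
qed

text \<open>
  The local lower bound for the number of partitions: on \<open>|t| \<le> K s^(3/2)\<close> the integrand is close to
  \<open>exp (- V t^2 / 2)\<close>, and a large constant \<open>K\<close> makes the remaining range negligible.
\<close>

lemma fourier_coeff_lower:
  obtains c0 s0 where "c0 > 0" "0 < s0" "s0 \<le> 1/2"
    "\<And>n s. 0 < s \<Longrightarrow> s \<le> s0 \<Longrightarrow> real n * s^2 = pi^2 / 6 \<Longrightarrow> c0 * sqrt (s^3) \<le> Re (fourier_coeff s n (int n))"
proof -
  define E where "E = exp (-16 :: real)"
  \<comment> \<open>\<open>K\<close> makes the two outer integrals together at most half of the main term \<open>2 a E\<close>; \<open>M s^2\<close> bounds the
    error of the Gaussian approximation on the inner range.\<close>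
  define K where "K = 2 * decay_const * pi * exp 16"
  define M where "M = 864 * K^4 + 520 * K^2"
  define e where "e = min (1/2) (min (E / (2 * M)) (pi / K))"
  have E: "E > 0" by (simp add: E_def)
  have K: "K \<ge> 1"
  proof -
    have "1 * 1 * 1 * 1 \<le> K" unfolding K_def
      using decay_const_ge_1 pi_gt3 by (intro mult_mono) auto
    then show ?thesis by simp
  qed
  have M: "M > 0" unfolding M_def using K by (intro add_pos_pos) auto
  have "0 < e" unfolding e_def using E M K by simp
  moreover have "e \<le> 1/2" "e \<le> E / (2 * M)" "e \<le> pi / K"
    unfolding e_def by (meson min.cobounded1 min.cobounded2 order_trans)+
  ultimately have e: "0 < e" "e \<le> 1/2" "e \<le> E / (2 * M)" "e \<le> pi / K" by blast+
  show thesis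
  proof (rule that[of "E/2" "e^2"])
    show "E / 2 > 0" "0 < e^2" using E e by auto
    have "e^2 \<le> (1/2)^2" using e by (intro power_mono) auto
    then show e2: "e^2 \<le> 1/2" by (simp add: power2_eq_square)
    fix n s assume s: "0 < s" "s \<le> e^2" and n: "real n * s^2 = pi^2 / 6"
    have s2: "s \<le> 1/2" using s e2 by linarith
    note nb = scale_bounds[OF s(1) s2 n]
    have "sqrt s \<le> sqrt (e^2)" using s by (intro real_sqrt_le_mono) auto
    then have rs: "sqrt s \<le> e" using e by simp
    define a where "a = sqrt (s^3)"
    have a: "a > 0" "a^2 = s^3" "a = s * sqrt s" using s by (simp_all add: a_def) (simp add: sqrt_cube)
    have "a \<le> sqrt s" unfolding a(3) using s s2 mult_right_mono[of s 1 "sqrt s"] by simp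
    then have "a \<le> pi / K" using rs e by linarith
    \<comment> \<open>\<open>T\<close> separates the inner range from the two outer ranges.\<close>
    define T where "T = K * a"
    have T: "T > 0" "T \<le> pi" "a \<le> T"
    proof -
      show "T > 0" using K a by (simp add: T_def)
      show "T \<le> pi" using \<open>a \<le> pi / K\<close> K by (simp add: T_def field_simps)
      show "a \<le> T" using K a mult_right_mono[of 1 K a] by (simp add: T_def)
    qed
    define f where "f = (\<lambda>t. cis (- of_int (int n) * t) * size_char s n t)"
    have fi: "f integrable_on {u..v}" for u v
      unfolding f_def using s by (intro integrable_continuous_interval continuous_intros) auto
    have outer: "cmod (integral {u..v} f) \<le> a * E / 2"
      if uv: "{u..v} \<subseteq> {-pi..pi}" "\<And>t. t \<in> {u..v} \<Longrightarrow> \<bar>t\<bar> \<ge> T" for u v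
    proof -
      have ki: "kern s integrable_on {u..v}"
        using integrable_on_subinterval[OF kern_integral(1)[OF s(1)] uv(1)] .
      have "cmod (integral {u..v} f) \<le> integral {u..v} (\<lambda>t. decay_const * (a / T) * kern s t)"
      proof (rule integral_norm_bound_integral[OF fi])
        show "(\<lambda>t. decay_const * (a / T) * kern s t) integrable_on {u..v}"
          using integrable_cmul[OF ki, of "decay_const * (a / T)"] by simp
        fix t assume t: "t \<in> {u..v}"
        then have tp: "\<bar>t\<bar> \<le> pi" using uv(1) by auto
        note kb = kern_bounds[OF s(1), of t]
        have "cmod (f t) \<le> decay_const * kern s t ^ 4"
          unfolding f_def norm_mult using norm_size_char_le_decay[OF s(1) s2 nb(1) tp] by simp
        also have "\<dots> \<le> decay_const * kern s t ^ 2"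
          using kb decay_const_ge_1 by (intro mult_left_mono power_decreasing) auto
        also have "\<dots> = decay_const * (1 * kern s t) * kern s t" by (simp add: power2_eq_square)
        also have "\<dots> \<le> decay_const * (a / T) * kern s t"
        proof -
          have "T * kern s t \<le> \<bar>t\<bar> * kern s t" using uv(2)[OF t] kb by (intro mult_right_mono) auto
          also have "\<dots> \<le> a" unfolding a_def by (rule abs_mult_kern_le[OF s(1)])
          finally have "1 * kern s t \<le> a / T" using T by (simp add: field_simps)
          then show ?thesis using kb decay_const_ge_1 by (intro mult_right_mono mult_left_mono) auto
        qed
        finally show "cmod (f t) \<le> decay_const * (a / T) * kern s t" .
      qed
      also have "\<dots> = decay_const * (a / T) * integral {u..v} (kern s)" by simp
      also have "\<dots> \<le> decay_const * (a / T) * (pi * a)"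
      proof (rule mult_left_mono)
        have "integral {u..v} (kern s) \<le> integral {-pi..pi} (kern s)"
          using uv(1) ki kern_integral(1)[OF s(1)] kern_bounds[OF s(1)]
          by (intro integral_subset_le) (auto intro: less_imp_le)
        then show "integral {u..v} (kern s) \<le> pi * a"
          using kern_integral(2)[OF s(1)] unfolding a_def by linarith
      qed (use decay_const_ge_1 a T in auto)
      also have "\<dots> = a * E / 2"
        using a K decay_const_ge_1 unfolding T_def K_def E_def by (simp add: exp_minus field_simps)
      finally show ?thesis .
    qed
    let ?V = "size_var s n" and ?mu = "size_mean s n"
    define g where "g = (\<lambda>t. exp (- (?V * t^2 / 2)))"
    have gi: "g integrable_on {u..v}" for u v
      unfolding g_def by (intro integrable_continuous_interval continuous_intros) auto
    have near: "cmod (f t - of_real (g t)) \<le> 432 / s^4 * T^3 + 260 / s * T" if t: "t \<in> {-T..T}" for t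
    proof -
      have tT: "\<bar>t\<bar> \<le> T" using t by auto
      let ?e = "exp (\<i> * of_real (?mu * t) - of_real (?V * t^2 / 2))"
      have ge: "cis (- of_int (int n) * t) * ?e = cis ((?mu - real n) * t) * of_real (g t)"
        unfolding g_def cis_conv_exp exp_of_real[symmetric] exp_add[symmetric]
        by (simp add: algebra_simps)
      have "f t - of_real (g t) = cis (- of_int (int n) * t) * (size_char s n t - ?e)
          + (cis ((?mu - real n) * t) - 1) * of_real (g t)"
        unfolding f_def right_diff_distrib left_diff_distrib ge by simp
      then have "cmod (f t - of_real (g t)) \<le> cmod (cis (- of_int (int n) * t) * (size_char s n t - ?e))
          + cmod ((cis ((?mu - real n) * t) - 1) * of_real (g t))"
        by (simp only: norm_triangle_ineq)
      also have "\<dots> \<le> 432 / s^4 * \<bar>t\<bar>^3 + \<bar>(?mu - real n) * t\<bar> * 1"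
      proof (rule add_mono)
        show "cmod (cis (- of_int (int n) * t) * (size_char s n t - ?e)) \<le> 432 / s^4 * \<bar>t\<bar>^3"
          using size_char_gauss[OF s(1), of n t] by (simp only: norm_mult norm_cis mult_1_left)
        have "g t \<le> 1" "g t \<ge> 0" unfolding g_def using size_var_bounds(1)[OF s(1), of n] by auto
        then show "cmod ((cis ((?mu - real n) * t) - 1) * of_real (g t)) \<le> \<bar>(?mu - real n) * t\<bar> * 1"
          unfolding norm_mult by (intro mult_mono cmod_cis_diff) auto
      qed
      also have "\<dots> \<le> 432 / s^4 * T^3 + 260 / s * T"
      proof (rule add_mono)
        show "432 / s^4 * \<bar>t\<bar>^3 \<le> 432 / s^4 * T^3" using tT by (intro mult_left_mono power_mono) auto
        have "\<bar>?mu - real n\<bar> * \<bar>t\<bar> \<le> 260 / s * T"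
          using size_mean_approx[OF s(1) s2 n] tT s T by (intro mult_mono) auto
        then show "\<bar>(?mu - real n) * t\<bar> * 1 \<le> 260 / s * T" by (simp add: abs_mult)
      qed
      finally show ?thesis .
    qed
    have gc: "((\<lambda>t. complex_of_real (g t)) has_integral of_real (integral {-T..T} g)) {-T..T}"
      by (intro has_integral_of_real integrable_integral gi)
    have "cmod (integral {-T..T} f - of_real (integral {-T..T} g)) = cmod (integral {-T..T} (\<lambda>t. f t - of_real (g t)))"
      using gc fi by (subst integral_diff) (auto simp: integral_unique has_integral_integrable)
    also have "\<dots> \<le> integral {-T..T} (\<lambda>t. 432 / s^4 * T^3 + 260 / s * T)"
      using fi gc near by (intro integral_norm_bound_integral integrable_diff)
        (auto simp: has_integral_integrable)
    also have "\<dots> = 2 * T * (432 / s^4 * T^3 + 260 / s * T)" using T by simp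
    also have "\<dots> = 864 * K^4 * (a^2)^2 / s^4 + 520 * K^2 * a^2 / s"
      by (simp add: T_def eval_nat_numeral algebra_simps)
    also have "\<dots> = M * s^2"
      unfolding a(2) M_def using s by (simp add: eval_nat_numeral field_simps)
    also have "\<dots> = M * sqrt s * a"
      unfolding a(3) using s by (simp add: power2_eq_square)
    also have "\<dots> \<le> (E / 2) * a"
    proof (rule mult_right_mono)
      have "M * sqrt s \<le> M * (E / (2 * M))" using rs e M by (intro mult_left_mono) auto
      then show "M * sqrt s \<le> E / 2" using M by simp
    qed (use a in simp)
    finally have inner: "cmod (integral {-T..T} f - of_real (integral {-T..T} g)) \<le> E / 2 * a" .
    have "2 * a * E = integral {-a..a} (\<lambda>_. E)" using a by simp
    also have "\<dots> \<le> integral {-a..a} g"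
    proof (rule integral_le[OF _ gi])
      fix t assume "t \<in> {-a..a}"
      then have "t^2 \<le> a^2" by (intro power2_le_iff_abs_le[THEN iffD2]) auto
      then have "?V * t^2 \<le> 32 / s^3 * s^3"
        using size_var_bounds[OF s(1), of n] s unfolding a(2) by (intro mult_mono) auto
      then show "E \<le> g t" using s unfolding E_def g_def by simp
    qed auto
    also have "\<dots> \<le> integral {-T..T} g"
      using T gi by (intro integral_subset_le) (auto simp: g_def)
    finally have main: "2 * a * E \<le> integral {-T..T} g" .
    have "integral {-pi..pi} f = integral {-pi..-T} f + (integral {-T..T} f + integral {T..pi} f)"
      using Henstock_Kurzweil_Integration.integral_combine[where a = "-pi" and c = "-T" and b = pi and f = f]
        Henstock_Kurzweil_Integration.integral_combine[where a = "-T" and c = T and b = pi and f = f] T fi by simp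
    then have "Re (integral {-pi..pi} f)
        = Re (integral {-pi..-T} f) + Re (integral {-T..T} f) + Re (integral {T..pi} f)" by simp
    moreover have "cmod (integral {-pi..-T} f) \<le> a * E / 2" "cmod (integral {T..pi} f) \<le> a * E / 2"
      using T by (intro outer; auto)+
    moreover have "\<bar>Re (integral {-T..T} f) - integral {-T..T} g\<bar> \<le> a * E / 2"
      using abs_Re_le_cmod[of "integral {-T..T} f - of_real (integral {-T..T} g)"] inner
      by (simp add: mult.commute)
    ultimately have "a * E / 2 \<le> Re (integral {-pi..pi} f)"
      using main abs_Re_le_cmod[of "integral {-pi..-T} f"] abs_Re_le_cmod[of "integral {T..pi} f"]
      by linarith
    moreover have "a * E / 2 = E / 2 * a" by simp
    ultimately show "E / 2 * sqrt (s^3) \<le> Re (fourier_coeff s n (int n))"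
      unfolding fourier_coeff_def f_def a_def by simp
  qed
qed

lemma wsum_bounds:
  obtains C s0 where "C > 0" "0 < s0" "s0 \<le> 1/2"
    "\<And>n s. 0 < s \<Longrightarrow> s \<le> s0 \<Longrightarrow> real n * s^2 = pi^2 / 6 \<Longrightarrow> wsum 1 (int n) > 0"
    "\<And>n s j k. 0 < s \<Longrightarrow> s \<le> s0 \<Longrightarrow> real n * s^2 = pi^2 / 6 \<Longrightarrow> 1 \<le> j \<Longrightarrow> j \<le> 4 \<Longrightarrow>
       wsum j (int n - int k) \<le> C * s^(j-1) * exp (- real k * s) * wsum 1 (int n)"
    "\<And>n s k. 0 < s \<Longrightarrow> s \<le> s0 \<Longrightarrow> real n * s^2 = pi^2 / 6 \<Longrightarrow>
       \<bar>wsum 2 (int n - int k) - (1 - exp (-s)) * exp (- real k * s) * wsum 1 (int n)\<bar>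
        \<le> C * (1 + s * real k) * sqrt (s^3) * exp (- real k * s) * wsum 1 (int n)"
proof -
  obtain c0 s0 where c0: "c0 > 0" "0 < s0" "s0 \<le> 1/2" and
    low: "\<And>n s. 0 < s \<Longrightarrow> s \<le> s0 \<Longrightarrow> real n * s^2 = pi^2 / 6 \<Longrightarrow> c0 * sqrt (s^3) \<le> Re (fourier_coeff s n (int n))"
    using fourier_coeff_lower by blast
  define C where "C = 216 * decay_const * pi / c0"
  show thesis
  proof (rule that[of C s0])
    show "C > 0" "0 < s0" "s0 \<le> 1/2" using c0 decay_const_ge_1 by (auto simp: C_def)
  next
    fix n s assume s: "0 < s" "s \<le> s0" and n: "real n * s^2 = pi^2 / 6"
    have s2: "s \<le> 1/2" using s c0 by linarith
    note nb = scale_bounds[OF s(1) s2 n]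
    define a where "a = sqrt (s^3)"
    have a: "a > 0" using s by (simp add: a_def)
    define Z where "Z = exp (real n * s) * part_gf s n"
    have Z: "Z > 0" unfolding Z_def using part_gf_pos[OF s(1)] by simp
    let ?p = "wsum 1 (int n)"
    have "of_real (2 * pi * ?p) = of_real Z * fourier_coeff s n (int n)"
      using fourier_part_count[OF s(1), of "int n" n] wsum_1[of "int n" n] by (simp add: Z_def)
    then have "Re (of_real (2 * pi * ?p)) = Re (of_real Z * fourier_coeff s n (int n))" by (rule arg_cong)
    then have p: "2 * pi * ?p = Z * Re (fourier_coeff s n (int n))" by simp
    have "Z * (c0 * a) \<le> Z * Re (fourier_coeff s n (int n))"
      unfolding a_def using low[OF s n] Z by (intro mult_left_mono) auto
    then have Za: "Z * a \<le> 2 * pi * ?p / c0" using p c0 by (simp add: field_simps)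
    have "Z * a > 0" using Z a by simp
    then have "2 * pi * ?p / c0 > 0" using Za by linarith
    then show p0: "?p > 0" using c0 by (simp add: zero_less_divide_iff zero_less_mult_iff)
    have four: "of_real (2 * pi * wsum j (int n - int k)) = complex_of_real (Z * exp (- real k * s)) *
           integral {-pi..pi} (\<lambda>t. size_char s n t * (cis (- of_int (int n - int k) * t) * gap_factor s j t))"
      if "j \<ge> 1" for j k
    proof -
      have "exp (of_int (int n - int k) * s) = exp (real n * s) * exp (- real k * s)"
        by (simp add: exp_add[symmetric] algebra_simps)
      then show ?thesis using fourier_wsum[OF s(1) that, of "int n - int k" n]
        by (simp add: Z_def mult_ac)
    qed
    show "wsum j (int n - int k) \<le> C * s^(j-1) * exp (- real k * s) * ?p" if j: "1 \<le> j" "j \<le> 4" for j k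
    proof -
      have "2 * pi * wsum j (int n - int k) = cmod (of_real (2 * pi * wsum j (int n - int k)))"
        by (simp only: norm_of_real) (simp add: wsum_nonneg)
      also have "\<dots> = Z * exp (- real k * s) *
         cmod (integral {-pi..pi} (\<lambda>t. size_char s n t * (cis (- of_int (int n - int k) * t) * gap_factor s j t)))"
        unfolding four[OF j(1)] norm_mult norm_of_real using Z by simp
      also have "\<dots> \<le> Z * exp (- real k * s) * (decay_const * (216 * s^(j-1)) * (pi * sqrt (s^3)))"
        using Z s by (intro mult_left_mono norm_integral_size_char_le s2 nb kern_gap_factor_le j continuous_intros) auto
      also have "\<dots> = (Z * a) * (exp (- real k * s) * decay_const * 216 * s^(j-1) * pi)"
        by (simp add: a_def mult_ac)
      also have "\<dots> \<le> (2 * pi * ?p / c0) * (exp (- real k * s) * decay_const * 216 * s^(j-1) * pi)"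
        using Za s decay_const_ge_1 by (intro mult_right_mono) auto
      also have "\<dots> = 2 * pi * (C * s^(j-1) * exp (- real k * s) * ?p)"
        by (simp add: C_def)
      finally show ?thesis by simp
    qed
    show "\<bar>wsum 2 (int n - int k) - (1 - exp (-s)) * exp (- real k * s) * ?p\<bar>
        \<le> C * (1 + s * real k) * sqrt (s^3) * exp (- real k * s) * ?p" for k
    proof -
      let ?D = "wsum 2 (int n - int k) - (1 - exp (-s)) * exp (- real k * s) * ?p"
      let ?f = "\<lambda>t. size_char s n t * (cis (- of_int (int n - int k) * t) * gap_factor s 2 t)"
      let ?g = "\<lambda>t. cis (- of_int (int n) * t) * size_char s n t"
      let ?h = "\<lambda>t. size_char s n t * (cis (- of_int (int n) * t) * (cis (real k * t) * gap_factor s 2 t - of_real (1 - exp (- s))))"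
      have h: "?h t = ?f t - of_real (1 - exp (-s)) * ?g t" for t
      proof -
        have "cis (- of_int (int n - int k) * t) = cis (- of_int (int n) * t) * cis (real k * t)"
          by (simp add: cis_mult algebra_simps)
        then show ?thesis by (simp add: algebra_simps)
      qed
      have fi: "?f integrable_on {-pi..pi}"
        using s by (intro integrable_continuous_interval continuous_intros) auto
      have H: "integral {-pi..pi} ?h = integral {-pi..pi} ?f - of_real (1 - exp (-s)) * fourier_coeff s n (int n)"
        unfolding h fourier_coeff_def using fi fourier_coeff_integrable[OF s(1), of "int n" n]
        by (subst integral_diff) (auto intro!: integrable_on_cmult_left simp del: of_real_diff)
      have P: "of_real (2 * pi * ?p) = of_real Z * fourier_coeff s n (int n)" by fact
      have "complex_of_real (2 * pi * ?D) = of_real (2 * pi * wsum 2 (int n - int k))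
          - of_real ((1 - exp (-s)) * exp (- real k * s)) * of_real (2 * pi * ?p)"
        by (simp add: algebra_simps)
      also have "\<dots> = of_real (Z * exp (- real k * s)) * integral {-pi..pi} ?h"
        unfolding H P using four[of 2 k] by (simp add: algebra_simps)
      finally have D: "complex_of_real (2 * pi * ?D) = of_real (Z * exp (- real k * s)) * integral {-pi..pi} ?h" .
      have "2 * pi * \<bar>?D\<bar> = cmod (of_real (2 * pi * ?D))"
        by (simp only: norm_of_real abs_mult) simp
      also have "\<dots> = Z * exp (- real k * s) * cmod (integral {-pi..pi} ?h)"
        unfolding D norm_mult norm_of_real using Z by simp
      also have "\<dots> \<le> Z * exp (- real k * s) * (decay_const * ((1 + s * real k) * sqrt (s^3)) * (pi * sqrt (s^3)))"
        using Z s by (intro mult_left_mono norm_integral_size_char_le s2 nb kern_two_term_le continuous_intros) auto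
      also have "\<dots> = (Z * a) * (exp (- real k * s) * decay_const * (1 + s * real k) * sqrt (s^3) * pi)"
        by (simp add: a_def mult_ac)
      also have "\<dots> \<le> (2 * pi * ?p / c0) * (exp (- real k * s) * decay_const * (1 + s * real k) * sqrt (s^3) * pi)"
        using Za s decay_const_ge_1 by (intro mult_right_mono) auto
      also have "\<dots> = 1 * (2 * pi * (decay_const * pi / c0 * (1 + s * real k) * sqrt (s^3) * exp (- real k * s) * ?p))"
        by simp
      also have "\<dots> \<le> 216 * (2 * pi * (decay_const * pi / c0 * (1 + s * real k) * sqrt (s^3) * exp (- real k * s) * ?p))"
        using s p0 c0 decay_const_ge_1 by (intro mult_right_mono) auto
      also have "\<dots> = 2 * pi * (C * (1 + s * real k) * sqrt (s^3) * exp (- real k * s) * ?p)"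
        by (simp add: C_def)
      finally show ?thesis by simp
    qed
  qed
qed

section \<open>The Lambert series and the conclusion\<close>

lemma mean_mult_le: assumes "s > 0" "k \<ge> 1" shows "mean_mult s k \<le> 1 / (real k * s)"
proof -
  have "real k * s > 0" using assms by simp
  moreover have "exp (real k * s) - 1 \<ge> real k * s" using exp_ge_add_one_self[of "real k * s"] by linarith
  ultimately show ?thesis unfolding mean_mult_def by (intro divide_left_mono) auto
qed

lemma harm_le_ln: assumes "n \<ge> 1" shows "harm n \<le> 1 + ln (real n)"
  using assms
proof (induction n rule: nat_induct_at_least)
  case base
  show ?case by (simp add: harm_def)
next
  case (Suc n)
  have "ln (real n / real (Suc n)) \<le> real n / real (Suc n) - 1"
    using Suc.hyps by (intro ln_le_minus_one) auto
  also have "\<dots> = - inverse (real (Suc n))" by (simp add: field_simps)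
  finally have "inverse (real (Suc n)) \<le> ln (real (Suc n)) - ln (real n)"
    using Suc.hyps by (simp add: ln_div del: of_nat_Suc)
  then show ?case using Suc.IH by (simp add: harm_Suc del: of_nat_Suc)
qed

text \<open>
  The function \<open>g\<close> extends to the nonincreasing derivative of \<open>G\<close>, so the increment of \<open>G\<close> lies between
  two consecutive values of \<open>g\<close>.
\<close>

lemma lambert_step:
  assumes s: "s > 0" and k: "k \<ge> 1"
  defines "G \<equiv> \<lambda>t::real. ln t - ln (1 - exp (- (t * s)))"
  defines "g \<equiv> \<lambda>k. 1 / real k - s * mean_mult s k"
  shows "g (Suc k) \<le> G (real (Suc k)) - G (real k)" "G (real (Suc k)) - G (real k) \<le> g k"
proof -
  define h where "h = (\<lambda>t::real. 1 / t - s * exp (- (t * s)) / (1 - exp (- (t * s))))"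
  have hg: "h (real k) = g k" if "k \<ge> 1" for k
    unfolding h_def g_def using mean_mult_alt(2)[OF s that] by simp
  have anti: "h v \<le> h u" if "0 < u" "u \<le> v" for u v
  proof (rule DERIV_nonpos_imp_nonincreasing[where f = h])
    fix x assume "u \<le> x"
    then have x: "x * s > 0" using that s by simp
    then have e: "1 - exp (- (x * s)) > 0" by simp
    have "DERIV h x :> - (1 / x^2) + s^2 * (exp (- (x * s)) / (1 - exp (- (x * s)))^2)"
      unfolding h_def using e x
      by (auto intro!: derivative_eq_intros simp: power2_eq_square field_simps)
    moreover have "s^2 * (exp (- (x * s)) / (1 - exp (- (x * s)))^2) \<le> s^2 * (1 / (x * s)^2)"
      by (intro mult_left_mono exp_neg_kernel_upper x) auto
    moreover have "s^2 * (1 / (x * s)^2) = 1 / x^2" using s by (simp add: power_mult_distrib)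
    ultimately show "\<exists>y. DERIV h x :> y \<and> y \<le> 0" by (intro exI conjI) auto
  qed (use that in auto)
  have "\<exists>z. real k < z \<and> z < real (Suc k) \<and> G (real (Suc k)) - G (real k) = (real (Suc k) - real k) * h z"
  proof (rule MVT2)
    fix x assume "real k \<le> x"
    then have x: "x > 0" "x * s > 0" using k s by auto
    then have "1 - exp (- (x * s)) > 0" by simp
    then show "DERIV G x :> h x" unfolding G_def h_def using x
      by (auto intro!: derivative_eq_intros simp: field_simps)
  qed simp
  then obtain z where z: "real k < z" "z < real (Suc k)" "G (real (Suc k)) - G (real k) = h z" by auto
  show "G (real (Suc k)) - G (real k) \<le> g k" unfolding z(3) hg[OF k, symmetric] using z k by (intro anti) auto
  have "h (real (Suc k)) \<le> h z" using z k by (intro anti) auto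
  then show "g (Suc k) \<le> G (real (Suc k)) - G (real k)" unfolding z(3) using hg[of "Suc k"] by simp
qed

text \<open>
  The sum of \<open>g k = 1/k - s mean_mult s k\<close> over \<open>1 \<le> k \<le> n\<close> differs from \<open>G (n+1) - G 1\<close> by at most
  \<open>g 1 \<le> s\<close>; Euler's constant enters through the harmonic sum.
\<close>

lemma lambert_sum:
  assumes s: "0 < s" "s \<le> 1/2" and n: "real n * s^2 = pi^2 / 6"
  shows "\<bar>s * (\<Sum>k=1..n. mean_mult s k) - (euler_mascheroni - ln s)\<bar> \<le> 4 * s"
proof -
  define G where "G = (\<lambda>t::real. ln t - ln (1 - exp (- (t * s))))"
  define g where "g = (\<lambda>k. 1 / real k - s * mean_mult s k)"
  have nb: "real n * s \<ge> 1" "real n \<ge> 1" by (rule scale_bounds[OF s n])+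
  have pi2: "pi^2 / 6 \<ge> 1" using power_mono[of 3 pi 2] pi_gt3 by simp
  have step: "g (Suc k) \<le> G (real (Suc k)) - G (real k)" "G (real (Suc k)) - G (real k) \<le> g k" if "k \<ge> 1" for k
    using lambert_step[OF s(1) that] unfolding G_def g_def by blast+
  have tele: "(\<Sum>k=1..n. G (real (Suc k)) - G (real k)) = G (real (Suc n)) - G 1"
    using sum_Suc_diff[of 1 n "\<lambda>k. G (real k)"] by simp
  have lo: "G (real (Suc n)) - G 1 \<le> (\<Sum>k=1..n. g k)"
    unfolding tele[symmetric] by (intro sum_mono step) auto
  have "(\<Sum>k=1..n. g (Suc k)) \<le> G (real (Suc n)) - G 1"
    unfolding tele[symmetric] by (intro sum_mono step) auto
  moreover have "(\<Sum>k=1..n. g (Suc k)) = (\<Sum>k=1..n. g k) + g (Suc n) - g 1"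
    using sum_Suc_diff[of 1 n g] by (simp add: sum_subtractf)
  moreover have "g (Suc n) \<ge> 0"
    using mult_left_mono[OF mean_mult_le[OF s(1), of "Suc n"], of s] s unfolding g_def by simp
  moreover have "g 1 \<le> s"
  proof -
    have "1 - s \<le> exp (-s)" using exp_ge_add_one_self[of "-s"] by simp
    also have "\<dots> \<le> s * mean_mult s 1"
    proof -
      have "exp s - 1 \<le> s * exp s"
      proof -
        have "exp s * (1 - exp (-s)) \<le> exp s * s" using one_minus_exp_bounds[of s] s by (intro mult_left_mono) auto
        then show ?thesis by (simp add: algebra_simps exp_minus)
      qed
      moreover have "exp s > 1" using s by simp
      ultimately show ?thesis unfolding mean_mult_def by (simp add: exp_minus field_simps)
    qed
    finally show ?thesis by (simp add: g_def)
  qed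
  ultimately have hi: "(\<Sum>k=1..n. g k) \<le> G (real (Suc n)) - G 1 + s" by linarith
  have sg: "(\<Sum>k=1..n. g k) = harm n - s * (\<Sum>k=1..n. mean_mult s k)"
    unfolding g_def by (simp add: sum_subtractf sum_distrib_left harm_def inverse_eq_divide)
  have G: "G (real (Suc n)) - G 1 = ln (real (Suc n)) - ln (1 - exp (- (real (Suc n) * s))) + ln (1 - exp (- s))"
    by (simp add: G_def)
  obtain n' where n': "n = Suc n'" using nb(2) by (cases n) auto
  have h1: "\<bar>harm n - ln (real (Suc n)) - euler_mascheroni\<bar> \<le> 1 / (2 * real n)"
  proof -
    have "euler_mascheroni \<le> harm n - ln (real (Suc n)) + 1 / (2 * real n)"
         "euler_mascheroni \<ge> harm n - ln (real (Suc n)) + 1 / (2 * real (Suc n))"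
      using euler_mascheroni_upper[of n'] euler_mascheroni_lower[of n'] unfolding n'
      by (simp_all add: inverse_eq_divide field_simps)
    moreover have "1 / (2 * real (Suc n)) \<ge> 0" "1 / (2 * real n) \<ge> 0" by simp_all
    ultimately show ?thesis by linarith
  qed
  have "1 / (2 * real n) \<le> s"
  proof -
    have "s * s \<le> 1 * s" using s by (intro mult_right_mono) auto
    then have "real n * (s * s) \<le> real n * s" by (intro mult_left_mono) auto
    then have "1 \<le> 2 * real n * s" using nb by linarith
    then show ?thesis using nb by (simp add: field_simps)
  qed
  moreover have "ln (1 - exp (-s)) \<le> ln s" "ln s - s \<le> ln (1 - exp (-s))"
  proof -
    have p: "1 - exp (-s) > 0" using s by simp
    show "ln (1 - exp (-s)) \<le> ln s" using p one_minus_exp_bounds[of s] s by (simp add: ln_le_cancel_iff)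
    have "s * exp (-s) \<le> 1 - exp (-s)"
    proof -
      have "(1 + s) * exp (-s) \<le> exp s * exp (-s)" using exp_ge_add_one_self[of s] by (intro mult_right_mono) auto
      then show ?thesis by (simp add: exp_minus algebra_simps)
    qed
    then have "ln (s * exp (-s)) \<le> ln (1 - exp (-s))" using s by (intro ln_mono) auto
    then show "ln s - s \<le> ln (1 - exp (-s))" using s by (simp add: ln_mult)
  qed
  moreover have "ln (1 - exp (- (real (Suc n) * s))) \<le> 0" "- s \<le> ln (1 - exp (- (real (Suc n) * s)))"
  proof -
    let ?u = "real (Suc n) * s"
    have u: "?u > 0" using s by simp
    have p: "0 < 1 - exp (- ?u)" "1 - exp (- ?u) \<le> 1" using u by simp_all
    then show "ln (1 - exp (- ?u)) \<le> 0" by (simp add: ln_le_zero_iff)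
    have "1 / s \<le> ?u"
    proof -
      have "1 / s \<le> (real n * s^2) / s" unfolding n using pi2 s by (intro divide_right_mono) auto
      also have "\<dots> = real n * s" using s by (simp add: power2_eq_square)
      also have "\<dots> \<le> ?u" using s by simp
      finally show ?thesis .
    qed
    then have us: "1 / ?u \<le> s" using u s by (simp add: field_simps)
    have "ln (1 / (1 - exp (- ?u))) \<le> ln (1 + 1 / ?u)"
    proof (rule ln_mono)
      show "1 / (1 - exp (- ?u)) \<le> 1 + 1 / ?u" using exp_neg_bounds(2)[OF u] u by (simp add: field_simps)
      show "1 / (1 - exp (- ?u)) > 0" using p by simp
    qed
    also have "\<dots> \<le> 1 / ?u" using u by (intro ln_add_one_self_le_self) auto
    finally have "ln (1 / (1 - exp (- ?u))) \<le> s" using us by linarith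
    moreover have "ln (1 / y) = - ln y" if "y > 0" for y :: real using that by (simp add: ln_div)
    ultimately have "- ln (1 - exp (- ?u)) \<le> s" using p(1) by simp
    then show "- s \<le> ln (1 - exp (- ?u))" by simp
  qed
  ultimately show ?thesis using lo hi h1 unfolding sg G by linarith
qed

lemma double_exp_sum_le:
  assumes "u > 0" "j \<ge> 1"
  shows "(\<Sum>a=j..n. \<Sum>b=1..n. exp (- real (a * b) * u)) \<le> (1 + ln (real n)) / u"
proof (cases "n = 0")
  case False
  have "(\<Sum>a=j..n. \<Sum>b=1..n. exp (- real (a * b) * u)) \<le> (\<Sum>a=1..n. \<Sum>b=1..n. exp (- real (a * b) * u))"
    using assms by (intro sum_mono2) (auto intro!: sum_nonneg)
  also have "\<dots> \<le> (\<Sum>a=1..n. inverse (real a) * (1 / u))"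
  proof (rule sum_mono)
    fix a assume a: "a \<in> {1..n}"
    have "(\<Sum>b=1..n. exp (- real (a * b) * u)) = (\<Sum>b=1..n. exp (- real b * (real a * u)))"
      by (intro sum.cong) (auto simp: algebra_simps)
    also have "\<dots> \<le> 1 / (real a * u)" using a assms by (intro sum_exp_le) auto
    finally show "(\<Sum>b=1..n. exp (- real (a * b) * u)) \<le> inverse (real a) * (1 / u)"
      by (simp add: inverse_eq_divide)
  qed
  also have "\<dots> = harm n * (1 / u)" by (simp only: harm_def sum_distrib_right)
  also have "\<dots> \<le> (1 + ln (real n)) * (1 / u)"
    using assms False harm_le_ln[of n] by (intro mult_right_mono) auto
  finally show ?thesis by simp
qed (use assms in simp)

text \<open>
  The inner geometric sums are cut off at \<open>b = n\<close>; their tails sum to at most the constant \<open>R \<le> 81\<close>.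
\<close>

lemma main_sum:
  assumes s: "0 < s" "s \<le> 1/2" and n: "real n * s^2 = pi^2 / 6"
  shows "\<bar>(\<Sum>a=2..n. \<Sum>b=1..n. (1 - exp (-s)) * exp (- real (a * b) * s)) - (euler_mascheroni - ln s - 1)\<bar>
         \<le> s * (87 + ln (real n))"
proof -
  note nb = scale_bounds[OF s n]
  define x where "x = 1 - exp (-s)"
  have x: "0 \<le> x" "x \<le> s" using one_minus_exp_bounds[of s] s by (auto simp: x_def)
  have xs: "s - s^2 \<le> x"
  proof -
    have "s / (1 + s) \<le> x" using exp_neg_bounds[OF s(1)] s unfolding x_def by (simp add: field_simps)
    moreover have "s - s^2 \<le> s / (1 + s)" using s by (simp add: field_simps power2_eq_square)
    ultimately show ?thesis by linarith
  qed
  define D where "D = (\<Sum>k=1..n. mean_mult s k)"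
  have D0: "D \<ge> 0" unfolding D_def using s by (intro sum_nonneg mean_mult_nonneg)
  have "D \<le> (\<Sum>k=1..n. inverse (real k) * (1 / s))"
    unfolding D_def using mean_mult_le[OF s(1)] by (intro sum_mono) (simp add: inverse_eq_divide)
  also have "\<dots> = harm n * (1 / s)" by (simp only: harm_def sum_distrib_right)
  also have "\<dots> \<le> (1 + ln (real n)) * (1 / s)" using s nb harm_le_ln[of n] by (intro mult_right_mono) auto
  finally have D: "s * D \<le> 1 + ln (real n)" using s by (simp add: field_simps)
  have row: "(\<Sum>b=1..n. exp (- real (a * b) * s)) = mean_mult s a - mean_mult s a * exp (- (real a * s)) ^ n"
    if "a \<ge> 1" for a
  proof -
    let ?y = "exp (- (real a * s))"
    have y: "?y < 1" using that s by simp
    have "(\<Sum>b=1..n. exp (- real (a * b) * s)) = (\<Sum>b=1..n. ?y ^ b)"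
      by (intro sum.cong) (auto simp: exp_of_nat_mult[symmetric] algebra_simps)
    also have "\<dots> = ?y / (1 - ?y) * (1 - ?y ^ n)"
      using y that s by (subst sum_gp) (auto simp: field_simps)
    also have "?y / (1 - ?y) = mean_mult s a" using mean_mult_alt(2)[OF s(1) that] by simp
    finally show ?thesis by (simp add: right_diff_distrib)
  qed
  define R where "R = (\<Sum>a=2..n. mean_mult s a * exp (- (real a * s)) ^ n)"
  have n3: "real n \<le> 3 / s^2"
  proof -
    have "pi^2 / 6 \<le> 3" using power_mono[of pi 4 2] pi_less_4 by simp
    then have "real n * s^2 \<le> 3" using n by simp
    then show ?thesis using s by (simp add: field_simps)
  qed
  have "R \<le> (\<Sum>a=2..n. 1 / s * exp (- (real n * s)))"
    unfolding R_def
  proof (intro sum_mono mult_mono)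
    fix a assume a: "a \<in> {2..n}"
    have "mean_mult s a \<le> 1 / (real a * s)" using a s by (intro mean_mult_le) auto
    also have "\<dots> \<le> 1 / s" using a s by (intro divide_left_mono) auto
    finally show "mean_mult s a \<le> 1 / s" .
    have "exp (- (real a * s)) ^ n \<le> exp (- s) ^ n" using a s by (intro power_mono) auto
    then show "exp (- (real a * s)) ^ n \<le> exp (- (real n * s))"
      by (simp add: exp_of_nat_mult[symmetric])
  qed (use s in auto)
  also have "\<dots> \<le> real n * (1 / s * exp (- (real n * s)))" using s by (simp add: divide_right_mono mult_right_mono)
  also have "\<dots> \<le> (3 / s^2) * (1 / s * (27 * s^3))"
  proof (intro mult_mono n3)
    have pi2: "pi^2 / 6 \<ge> 1" using power_mono[of 3 pi 2] pi_gt3 by simp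
    have "1 / s \<le> (real n * s^2) / s" unfolding n using pi2 s by (intro divide_right_mono) auto
    then have "exp (- (real n * s)) \<le> exp (- (1 / s))" using s by (simp add: power2_eq_square)
    also have "\<dots> \<le> (real 3 / (1 / s))^3" using s by (intro exp_neg_le) auto
    also have "\<dots> = 27 * s^3" by (simp add: power_mult_distrib)
    finally show "exp (- (real n * s)) \<le> 27 * s^3" .
  qed (use s in auto)
  also have "\<dots> = 81" using s by (simp add: field_simps eval_nat_numeral)
  finally have R: "R \<le> 81" .
  have R0: "R \<ge> 0" unfolding R_def using s by (intro sum_nonneg mult_nonneg_nonneg mean_mult_nonneg) auto
  have "(\<Sum>a=2..n. \<Sum>b=1..n. (1 - exp (-s)) * exp (- real (a * b) * s))
      = x * (\<Sum>a=2..n. \<Sum>b=1..n. exp (- real (a * b) * s))"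
    by (simp only: sum_distrib_left x_def)
  also have "(\<Sum>a=2..n. \<Sum>b=1..n. exp (- real (a * b) * s)) = (\<Sum>a=2..n. mean_mult s a) - R"
    unfolding R_def sum_subtractf[symmetric] by (intro sum.cong refl row) auto
  also have "(\<Sum>a=2..n. mean_mult s a) = D - mean_mult s 1"
    unfolding D_def using nb by (subst (2) sum.atLeast_Suc_atMost) (auto simp: numeral_2_eq_2)
  also have "x * (D - mean_mult s 1 - R) = x * D - x * mean_mult s 1 - x * R" by (simp only: right_diff_distrib)
  also have "x * mean_mult s 1 = exp (-s)"
    using mean_mult_alt(2)[OF s(1), of 1] s unfolding x_def by simp
  finally have eq: "(\<Sum>a=2..n. \<Sum>b=1..n. (1 - exp (-s)) * exp (- real (a * b) * s)) = x * D - exp (-s) - x * R" .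
  have "x * R \<le> s * 81" using x R R0 by (intro mult_mono) auto
  moreover have "x * R \<ge> 0" using x R0 by simp
  moreover have "x * D \<le> s * D" using x D0 by (intro mult_right_mono) auto
  moreover have "s * D - (s + s * ln (real n)) \<le> x * D"
  proof -
    have "(s - s^2) * D \<le> x * D" using xs D0 by (intro mult_right_mono) auto
    moreover have "s * (s * D) \<le> s * (1 + ln (real n))" using D s by (intro mult_left_mono) auto
    then have "s * (s * D) \<le> s + s * ln (real n)" by (simp only: distrib_left mult_1_right)
    moreover have "(s - s^2) * D = s * D - s * (s * D)" by (simp add: power2_eq_square algebra_simps)
    ultimately show ?thesis by linarith
  qed
  moreover have "1 - s \<le> exp (-s)" "exp (-s) \<le> 1" using x unfolding x_def by linarith+
  moreover have "\<bar>s * D - (euler_mascheroni - ln s)\<bar> \<le> 4 * s" unfolding D_def by (rule lambert_sum[OF s n])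
  moreover have "s * ln (real n) \<ge> 0" using s nb by simp
  ultimately have "\<bar>x * D - exp (-s) - x * R - (euler_mascheroni - ln s - 1)\<bar> \<le> 87 * s + s * ln (real n)"
    by linarith
  then show ?thesis unfolding eq by (simp add: distrib_left mult.commute)
qed

lemma one_add_mult_exp_le:
  fixes u :: real assumes "u \<ge> 0" shows "(1 + u) * exp (-u) \<le> 2 * exp (- (u/2))"
proof -
  have "1 + u \<le> 2 * exp (u/2)" using exp_ge_add_one_self[of "u/2"] assms by linarith
  then have "(1 + u) * exp (-u) \<le> 2 * exp (u/2) * exp (-u)" by (intro mult_right_mono) auto
  also have "\<dots> = 2 * exp (- (u/2))" by (simp add: exp_add[symmetric])
  finally show ?thesis .
qed

lemma excess_approx:
  obtains K s0 where "0 < s0"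
    "\<And>n s d. 0 < s \<Longrightarrow> s \<le> s0 \<Longrightarrow> real n * s^2 = pi^2 / 6 \<Longrightarrow>
       vsum 2 n / wsum 1 n \<le> d \<Longrightarrow> d \<le> (vsum 2 n + vsum 3 n + real n * wsum 4 n) / wsum 1 n \<Longrightarrow>
       \<bar>d - (euler_mascheroni - ln s - 1)\<bar> \<le> K * (sqrt s * (1 + ln (real n)))"
proof -
  show thesis
  proof (rule wsum_bounds)
    fix C s0 :: real
    assume C: "C > 0" "0 < s0" "s0 \<le> 1/2" and
      p0: "\<And>n s. 0 < s \<Longrightarrow> s \<le> s0 \<Longrightarrow> real n * s^2 = pi^2 / 6 \<Longrightarrow> wsum 1 (int n) > 0" and
      wj: "\<And>n s j k. 0 < s \<Longrightarrow> s \<le> s0 \<Longrightarrow> real n * s^2 = pi^2 / 6 \<Longrightarrow> 1 \<le> j \<Longrightarrow> j \<le> 4 \<Longrightarrow>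
         wsum j (int n - int k) \<le> C * s^(j-1) * exp (- real k * s) * wsum 1 (int n)" and
      w2: "\<And>n s k. 0 < s \<Longrightarrow> s \<le> s0 \<Longrightarrow> real n * s^2 = pi^2 / 6 \<Longrightarrow>
         \<bar>wsum 2 (int n - int k) - (1 - exp (-s)) * exp (- real k * s) * wsum 1 (int n)\<bar>
          \<le> C * (1 + s * real k) * sqrt (s^3) * exp (- real k * s) * wsum 1 (int n)"
    show thesis
    proof (rule that[of s0 "8 * C + 87"])
      show "0 < s0" by fact
      fix n s d assume s: "0 < s" "s \<le> s0" and n: "real n * s^2 = pi^2 / 6"
        and d: "vsum 2 n / wsum 1 n \<le> d" "d \<le> (vsum 2 n + vsum 3 n + real n * wsum 4 n) / wsum 1 n"
      have s2: "s \<le> 1/2" using s C by linarith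
      note nb = scale_bounds[OF s(1) s2 n]
      let ?p = "wsum 1 (int n)"
      have p: "?p > 0" by (rule p0[OF s n])
      define L where "L = 1 + ln (real n)"
      have L: "L \<ge> 1" unfolding L_def using nb by simp
      define q where "q = sqrt s"
      have q: "0 < q" "q^2 = s" "q \<le> 1" using s s2 by (auto simp: q_def)
      have sq: "s \<le> q" using q mult_right_mono[of q 1 q] by (simp add: power2_eq_square[symmetric])
      let ?M = "\<Sum>a=2..n. \<Sum>b=1..n. (1 - exp (-s)) * exp (- real (a * b) * s)"
      have "vsum 2 n / ?p - ?M
         = (\<Sum>a=2..n. \<Sum>b=1..n. wsum 2 (int n - int (a * b)) / ?p - (1 - exp (-s)) * exp (- real (a * b) * s))"
        by (subst vsum_convolution[of 2 "int n" n]) (simp_all add: sum_subtractf sum_divide_distrib del: of_nat_mult)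
      also have "\<bar>\<dots>\<bar> \<le> (\<Sum>a=2..n. \<Sum>b=1..n. 2 * C * sqrt (s^3) * exp (- real (a * b) * (s/2)))"
      proof (intro order_trans[OF sum_abs] sum_mono)
        fix a b :: nat
        let ?k = "a * b"
        let ?e = "exp (- real ?k * s)"
        have "\<bar>wsum 2 (int n - int ?k) / ?p - (1 - exp (-s)) * ?e\<bar>
            = \<bar>wsum 2 (int n - int ?k) - (1 - exp (-s)) * ?e * ?p\<bar> / ?p"
        proof -
          have "wsum 2 (int n - int ?k) / ?p - (1 - exp (-s)) * ?e = (wsum 2 (int n - int ?k) - (1 - exp (-s)) * ?e * ?p) / ?p"
            using p by (simp add: diff_divide_distrib)
          then show ?thesis using p by (simp only: abs_divide abs_of_pos)
        qed
        also have "\<dots> \<le> (C * (1 + s * real ?k) * sqrt (s^3) * ?e * ?p) / ?p"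
          using p w2[OF s n, of ?k] by (intro divide_right_mono) auto
        also have "\<dots> = C * sqrt (s^3) * ((1 + real ?k * s) * exp (- (real ?k * s)))"
          using p by (simp add: mult_ac)
        also have "\<dots> \<le> C * sqrt (s^3) * (2 * exp (- (real ?k * s / 2)))"
          using C s by (intro mult_left_mono one_add_mult_exp_le) auto
        also have "\<dots> = 2 * C * sqrt (s^3) * exp (- real ?k * (s/2))" by simp
        finally show "\<bar>wsum 2 (int n - int ?k) / ?p - (1 - exp (-s)) * ?e\<bar> \<le> 2 * C * sqrt (s^3) * exp (- real ?k * (s/2))" .
      qed
      also have "\<dots> = 2 * C * sqrt (s^3) * (\<Sum>a=2..n. \<Sum>b=1..n. exp (- real (a * b) * (s/2)))"
        by (simp only: sum_distrib_left)
      also have "\<dots> \<le> 2 * C * sqrt (s^3) * (L / (s/2))"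
        unfolding L_def using C s by (intro mult_left_mono double_exp_sum_le) auto
      also have "\<dots> = 4 * C * (q * L)"
        using s by (simp add: sqrt_cube q_def)
      finally have v2: "\<bar>vsum 2 n / ?p - ?M\<bar> \<le> 4 * C * (q * L)" .
      have "vsum 3 n / ?p = (\<Sum>a=3..n. \<Sum>b=1..n. wsum 3 (int n - int (a * b)) / ?p)"
        by (subst vsum_convolution[of 3 "int n" n]) (simp_all add: sum_divide_distrib del: of_nat_mult)
      also have "\<dots> \<le> (\<Sum>a=3..n. \<Sum>b=1..n. C * s^2 * exp (- real (a * b) * s))"
      proof (intro sum_mono)
        fix a b
        show "wsum 3 (int n - int (a * b)) / ?p \<le> C * s^2 * exp (- real (a * b) * s)"
          using wj[OF s n, of 3 "a * b"] p by (simp add: pos_divide_le_eq del: of_nat_mult)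
      qed
      also have "\<dots> = C * s^2 * (\<Sum>a=3..n. \<Sum>b=1..n. exp (- real (a * b) * s))"
        by (simp only: sum_distrib_left)
      also have "\<dots> \<le> C * s^2 * (L / s)"
        unfolding L_def using C s by (intro mult_left_mono double_exp_sum_le) auto
      also have "\<dots> = C * (s * L)" using s by (simp add: power2_eq_square)
      also have "\<dots> \<le> C * (q * L)" using C sq L by (intro mult_left_mono mult_right_mono) auto
      finally have v3: "vsum 3 n / ?p \<le> C * (q * L)" .
      have "wsum 4 n / ?p \<le> C * s^3" using wj[OF s n, of 4 0] p by (simp add: pos_divide_le_eq)
      then have "real n * (wsum 4 n / ?p) \<le> real n * (C * s^3)" by (intro mult_left_mono) auto
      also have "\<dots> = C * s * (real n * s^2)" by (simp add: power2_eq_square power3_eq_cube)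
      also have "\<dots> \<le> C * s * 3"
        unfolding n using power_mono[of pi 4 2] pi_less_4 C s by (intro mult_left_mono) auto
      also have "\<dots> \<le> 3 * C * (q * L)"
      proof -
        have "s * 1 \<le> q * L" using sq L q s by (intro mult_mono) auto
        then have "3 * C * (s * 1) \<le> 3 * C * (q * L)" using C by (intro mult_left_mono) auto
        moreover have "3 * C * (s * 1) = C * s * 3" by simp
        ultimately show ?thesis by linarith
      qed
      finally have w4: "real n * (wsum 4 n / ?p) \<le> 3 * C * (q * L)" .
      have "\<bar>?M - (euler_mascheroni - ln s - 1)\<bar> \<le> s * (87 + ln (real n))"
        by (rule main_sum[OF s(1) s2 n])
      also have "\<dots> \<le> q * (87 * L)"
      proof (rule mult_mono[OF sq])
        have "87 * L = 87 + 87 * ln (real n)" by (simp add: L_def)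
        then show "87 + ln (real n) \<le> 87 * L" using nb by simp
      qed (use nb q in auto)
      finally have M: "\<bar>?M - (euler_mascheroni - ln s - 1)\<bar> \<le> 87 * (q * L)" by (simp add: mult_ac)
      have "(vsum 2 n + vsum 3 n + real n * wsum 4 n) / ?p = vsum 2 n / ?p + vsum 3 n / ?p + real n * (wsum 4 n / ?p)"
        by (simp add: add_divide_distrib)
      then have "\<bar>d - (euler_mascheroni - ln s - 1)\<bar> \<le> 4 * C * (q * L) + C * (q * L) + 3 * C * (q * L) + 87 * (q * L)"
        using d v2 v3 w4 M by linarith
      also have "\<dots> = (8 * C + 87) * (q * L)" by (simp add: algebra_simps)
      finally show "\<bar>d - (euler_mascheroni - ln s - 1)\<bar> \<le> (8 * C + 87) * (sqrt s * (1 + ln (real n)))"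
        unfolding q_def L_def .
    qed
  qed
qed

theorem theorem2:
  fixes c C :: real
  assumes "c = pi / sqrt 6"
    and "C = ln c + 1 - euler_mascheroni"
  shows
    "(\<lambda>n::nat.
        measure_pmf.expectation (random_partition n)
          (\<lambda>ps. real (largest_part ps) * real (largest_part_mult ps))
        - (measure_pmf.expectation (random_partition n) (\<lambda>ps. real (largest_part ps))
           + 1 / 2 * ln (real n) - C))
      \<in> O(\<lambda>n. 1 / ln (real n))"
proof -
  have c: "c > 0" using assms by simp
  let ?f = "\<lambda>n::nat. measure_pmf.expectation (random_partition n)
          (\<lambda>ps. real (largest_part ps) * real (largest_part_mult ps))
        - (measure_pmf.expectation (random_partition n) (\<lambda>ps. real (largest_part ps))
           + 1 / 2 * ln (real n) - C)"
  show ?thesis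
  proof (rule excess_approx)
    fix K s0 :: real
    assume s0: "0 < s0" and app:
      "\<And>n s d. 0 < s \<Longrightarrow> s \<le> s0 \<Longrightarrow> real n * s^2 = pi^2 / 6 \<Longrightarrow>
         vsum 2 n / wsum 1 n \<le> d \<Longrightarrow> d \<le> (vsum 2 n + vsum 3 n + real n * wsum 4 n) / wsum 1 n \<Longrightarrow>
         \<bar>d - (euler_mascheroni - ln s - 1)\<bar> \<le> K * (sqrt s * (1 + ln (real n)))"
    let ?s = "\<lambda>n::nat. c / sqrt (real n)"
    have "((\<lambda>n::nat. c / sqrt (real n)) \<longlongrightarrow> 0) at_top" by real_asymp
    then have small: "\<forall>\<^sub>F n in at_top. ?s n < s0" using s0 by (rule order_tendstoD)
    have "?f \<in> O(\<lambda>n. sqrt (?s n) * (1 + ln (real n)))"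
    proof (rule bigoI)
      show "\<forall>\<^sub>F n in at_top. norm (?f n) \<le> K * norm (sqrt (?s n) * (1 + ln (real n)))"
        using small eventually_ge_at_top[of "1::nat"]
      proof eventually_elim
        case (elim n)
        then have n: "real n > 0" "n \<ge> 1" by auto
        have s: "?s n > 0" using c n by simp
        have "real n * (?s n)^2 = pi^2 / 6" using n unfolding assms(1) by (simp add: power_divide power_mult_distrib)
        from app[OF s less_imp_le[OF elim(1)] this expectation_excess[OF n(2)]]
        have "\<bar>?f n\<bar> \<le> K * (sqrt (?s n) * (1 + ln (real n)))"
          using n c by (simp add: assms(2) ln_div ln_sqrt algebra_simps)
        moreover have "sqrt (?s n) * (1 + ln (real n)) \<ge> 0" using s n by (intro mult_nonneg_nonneg) auto
        ultimately show ?case by (simp only: real_norm_def abs_of_nonneg)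
      qed
    qed
    also have "(\<lambda>n. sqrt (?s n) * (1 + ln (real n))) \<in> O(\<lambda>n. 1 / ln (real n))"
      using c by real_asymp
    finally show ?thesis .
  qed
qed

end
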